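(* Let $(\mathcal{B},\mathcal{A},i,e,l)$ be a cleft extension of abelian categories such that both $i$ and $e$ preserve coproducts, and let $F:\mathcal{B}\to\mathcal{B}$ be the associated endofunctor. Let $P_1\xrightarrow{\sigma}P_0\to B\to 0$ be a projective presentation of an object $B$ of $\mathcal{B}$ (so that $l(P_1)\xrightarrow{l(\sigma)}l(P_0)\to l(B)\to 0$ is a projective presentation of $l(B)$ in $\mathcal{A}$). Then: (1) $l(B)$ is a partial silting object in $\mathcal{A}$ with respect to $l(\sigma)$ if and only if $B$ is a partial silting object in $\mathcal{B}$ with respect to $\sigma$ and $F(B)\in\mathcal{D}_\sigma$. (2) $l(B)$ is a silting object in $\mathcal{A}$ with respect to $l(\sigma)$ if and only if $B$ is a silting object in $\mathcal{B}$ with respect to $\sigma$ and $F(B)\in\operatorname{Gen}(B)$.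
   Context: Standing assumptions: $\mathcal{A}$ and $\mathcal{B}$ are abelian categories with enough projective and enough injective objects, and with set-indexed coproducts. Cleft extension: a cleft extension $(\mathcal{B},\mathcal{A},i,e,l)$ of $\mathcal{B}$ consists of an abelian category $\mathcal{A}$ and functors $i:\mathcal{B}\to\mathcal{A}$, $e:\mathcal{A}\to\mathcal{B}$, $l:\mathcal{B}\to\mathcal{A}$ such that $e$ is faithful and exact, $l$ is left adjoint to $e$, and there is a natural isomorphism $ei\simeq \mathrm{Id}_{\mathcal{B}}$. It is known that then $i$ is fully faithful and exact and has a left adjoint $q:\mathcal{A}\to\mathcal{B}$, and $ql\simeq\mathrm{Id}_{\mathcal{B}}$. The functor $F$: let $\mu: le\to\mathrm{Id}_{\mathcal{A}}$ be the counit of $(l,e)$; each $\mu_A$ is an epimorphism. Put $G(A)=\ker\mu_A$ and $F=eGi:\mathcal{B}\to\mathcal{B}$. There is a split exact sequence of functors $0\to F\to el\to\mathrm{Id}_{\mathcal{B}}\to 0$. For a morphism $\sigma:X\to Y$ in an abelian category $\mathcal{C}$, $\mathcal{D}_\sigma$ is the class of objects $L$ of $\mathcal{C}$ such that $\operatorname{Hom}_{\mathcal{C}}(\sigma,L):\operatorname{Hom}_{\mathcal{C}}(Y,L)\to\operatorname{Hom}_{\mathcal{C}}(X,L)$ is surjective. $\operatorname{Gen}(X)$ is the class of quotients of coproducts of copies of $X$. A projective presentation of $X$ is an exact sequence $P_1\xrightarrow{\sigma}P_0\to X\to0$ with $P_0,P_1$ projective. Given such a presentation, $X$ is a partial silting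 object with respect to $\sigma$ if $X\in\mathcal{D}_\sigma$ and $\mathcal{D}_\sigma$ is a torsion class (equivalently, since $\mathcal{D}_\sigma$ is automatically closed under epimorphic images and extensions, $\mathcal{D}_\sigma$ is closed under coproducts). $X$ is a silting object with respect to $\sigma$ if $\operatorname{Gen}(X)=\mathcal{D}_\sigma$. *)

theory Defs
  imports "HOL-Algebra.Group"
begin

unbundle cardinal_syntax

section \<open>Categories\<close>

text \<open>
  Objects and morphisms are carved out of the types \<open>'o\<close> and \<open>'m\<close> by carrier sets. Composition is
  written in the usual right-to-left order. The fields \<open>Zero\<close> and \<open>Plus\<close> are only used for
  preadditive categories.
\<close>

record ('o, 'm) cat =
  Ob :: "'o set"
  Ar :: "'m set"
  Dom :: "'m \<Rightarrow> 'o"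
  Cod :: "'m \<Rightarrow> 'o"
  Ident :: "'o \<Rightarrow> 'm"
  Comp :: "'m \<Rightarrow> 'm \<Rightarrow> 'm" (infixr "\<cdot>\<index>" 70)
  Zero :: "'o \<Rightarrow> 'o \<Rightarrow> 'm"
  Plus :: "'m \<Rightarrow> 'm \<Rightarrow> 'm"

definition Hom :: "('o, 'm) cat \<Rightarrow> 'o \<Rightarrow> 'o \<Rightarrow> 'm set" where
  "Hom C X Y = {f \<in> Ar C. Dom C f = X \<and> Cod C f = Y}"

locale category =
  fixes C :: "('o, 'm) cat" (structure)
  assumes dom_in: "f \<in> Ar C \<Longrightarrow> Dom C f \<in> Ob C"
    and cod_in: "f \<in> Ar C \<Longrightarrow> Cod C f \<in> Ob C"
    and ident_in: "X \<in> Ob C \<Longrightarrow> Ident C X \<in> Hom C X X"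
    and comp_in: "\<lbrakk>f \<in> Hom C X Y; g \<in> Hom C Y Z\<rbrakk> \<Longrightarrow> g \<cdot> f \<in> Hom C X Z"
    and comp_ident: "f \<in> Hom C X Y \<Longrightarrow> f \<cdot> Ident C X = f"
    and ident_comp: "f \<in> Hom C X Y \<Longrightarrow> Ident C Y \<cdot> f = f"
    and comp_assoc: "\<lbrakk>f \<in> Hom C W X; g \<in> Hom C X Y; h \<in> Hom C Y Z\<rbrakk> \<Longrightarrow> (h \<cdot> g) \<cdot> f = h \<cdot> (g \<cdot> f)"

definition mono_ar :: "('o, 'm) cat \<Rightarrow> 'm \<Rightarrow> bool" where
  "mono_ar C f \<longleftrightarrow> f \<in> Ar C \<and>
     (\<forall>W. \<forall>g \<in> Hom C W (Dom C f). \<forall>h \<in> Hom C W (Dom C f).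
        f \<cdot>\<^bsub>C\<^esub> g = f \<cdot>\<^bsub>C\<^esub> h \<longrightarrow> g = h)"

definition epi_ar :: "('o, 'm) cat \<Rightarrow> 'm \<Rightarrow> bool" where
  "epi_ar C f \<longleftrightarrow> f \<in> Ar C \<and>
     (\<forall>W. \<forall>g \<in> Hom C (Cod C f) W. \<forall>h \<in> Hom C (Cod C f) W.
        g \<cdot>\<^bsub>C\<^esub> f = h \<cdot>\<^bsub>C\<^esub> f \<longrightarrow> g = h)"

definition iso_ar :: "('o, 'm) cat \<Rightarrow> 'm \<Rightarrow> bool" where
  "iso_ar C f \<longleftrightarrow> f \<in> Ar C \<and>
     (\<exists>g \<in> Hom C (Cod C f) (Dom C f).
        g \<cdot>\<^bsub>C\<^esub> f = Ident C (Dom C f) \<and> f \<cdot>\<^bsub>C\<^esub> g = Ident C (Cod C f))"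

definition projective_ob :: "('o, 'm) cat \<Rightarrow> 'o \<Rightarrow> bool" where
  "projective_ob C P \<longleftrightarrow> P \<in> Ob C \<and>
     (\<forall>g. epi_ar C g \<longrightarrow> (\<forall>f \<in> Hom C P (Cod C g). \<exists>h \<in> Hom C P (Dom C g). g \<cdot>\<^bsub>C\<^esub> h = f))"

definition injective_ob :: "('o, 'm) cat \<Rightarrow> 'o \<Rightarrow> bool" where
  "injective_ob C J \<longleftrightarrow> J \<in> Ob C \<and>
     (\<forall>g. mono_ar C g \<longrightarrow> (\<forall>f \<in> Hom C (Dom C g) J. \<exists>h \<in> Hom C (Cod C g) J. h \<cdot>\<^bsub>C\<^esub> g = f))"

definition enough_projectives :: "('o, 'm) cat \<Rightarrow> bool" where
  "enough_projectives C \<longleftrightarrow>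
     (\<forall>X \<in> Ob C. \<exists>P f. projective_ob C P \<and> f \<in> Hom C P X \<and> epi_ar C f)"

definition enough_injectives :: "('o, 'm) cat \<Rightarrow> bool" where
  "enough_injectives C \<longleftrightarrow>
     (\<forall>X \<in> Ob C. \<exists>J f. injective_ob C J \<and> f \<in> Hom C X J \<and> mono_ar C f)"


section \<open>Set-indexed coproducts\<close>

text \<open>
  HOL has no proper classes, so ``set-indexed'' is read relative to a type \<open>'u\<close>: the index sets are
  the subsets of \<open>'u\<close> of cardinality less than that of \<open>'u\<close> itself. The type \<open>'u\<close> is meant to
  have infinite regular cardinality; if this cardinal is strongly inaccessible, one obtains exactly
  the coproducts indexed by the (representatives of) sets of a Grothendieck universe.
\<close>

definition small :: "'u set \<Rightarrow> bool" where
  "small I \<longleftrightarrow> |I| <o |UNIV :: 'u set|"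

definition is_coproduct :: "('o, 'm) cat \<Rightarrow> 'u set \<Rightarrow> ('u \<Rightarrow> 'o) \<Rightarrow> 'o \<Rightarrow> ('u \<Rightarrow> 'm) \<Rightarrow> bool" where
  "is_coproduct C I X S \<iota> \<longleftrightarrow> S \<in> Ob C \<and> (\<forall>j \<in> I. \<iota> j \<in> Hom C (X j) S) \<and>
     (\<forall>Y \<in> Ob C. \<forall>f. (\<forall>j \<in> I. f j \<in> Hom C (X j) Y) \<longrightarrow>
        (\<exists>!h. h \<in> Hom C S Y \<and> (\<forall>j \<in> I. h \<cdot>\<^bsub>C\<^esub> \<iota> j = f j)))"

definition has_coproducts :: "'u itself \<Rightarrow> ('o, 'm) cat \<Rightarrow> bool" where
  "has_coproducts U C \<longleftrightarrow>
     (\<forall>(I :: 'u set) X. small I \<and> (\<forall>j \<in> I. X j \<in> Ob C) \<longrightarrow> (\<exists>S \<iota>. is_coproduct C I X S \<iota>))"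


section \<open>Abelian categories\<close>

definition hom_group :: "('o, 'm) cat \<Rightarrow> 'o \<Rightarrow> 'o \<Rightarrow> 'm monoid" where
  "hom_group C X Y = \<lparr>carrier = Hom C X Y, monoid.mult = Plus C, one = Zero C X Y\<rparr>"

locale preadditive_category = category C for C :: "('o, 'm) cat" (structure) +
  assumes hom_comm_group: "\<lbrakk>X \<in> Ob C; Y \<in> Ob C\<rbrakk> \<Longrightarrow> comm_group (hom_group C X Y)"
    and comp_plus: "\<lbrakk>f \<in> Hom C X Y; f' \<in> Hom C X Y; g \<in> Hom C Y Z\<rbrakk> \<Longrightarrow>
      g \<cdot> Plus C f f' = Plus C (g \<cdot> f) (g \<cdot> f')"
    and plus_comp: "\<lbrakk>f \<in> Hom C X Y; g \<in> Hom C Y Z; g' \<in> Hom C Y Z\<rbrakk> \<Longrightarrow>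
      Plus C g g' \<cdot> f = Plus C (g \<cdot> f) (g' \<cdot> f)"

definition zero_ob :: "('o, 'm) cat \<Rightarrow> 'o \<Rightarrow> bool" where
  "zero_ob C Z \<longleftrightarrow> Z \<in> Ob C \<and>
     (\<forall>X \<in> Ob C. (\<exists>!f. f \<in> Hom C X Z) \<and> (\<exists>!f. f \<in> Hom C Z X))"

definition is_biproduct :: "('o, 'm) cat \<Rightarrow> 'o \<Rightarrow> 'o \<Rightarrow> 'o \<Rightarrow> 'm \<Rightarrow> 'm \<Rightarrow> 'm \<Rightarrow> 'm \<Rightarrow> bool" where
  "is_biproduct C X Y S i\<^sub>1 i\<^sub>2 p\<^sub>1 p\<^sub>2 \<longleftrightarrow> S \<in> Ob C \<and>
     i\<^sub>1 \<in> Hom C X S \<and> i\<^sub>2 \<in> Hom C Y S \<and> p\<^sub>1 \<in> Hom C S X \<and> p\<^sub>2 \<in> Hom C S Y \<and>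
     p\<^sub>1 \<cdot>\<^bsub>C\<^esub> i\<^sub>1 = Ident C X \<and> p\<^sub>2 \<cdot>\<^bsub>C\<^esub> i\<^sub>2 = Ident C Y \<and>
     p\<^sub>2 \<cdot>\<^bsub>C\<^esub> i\<^sub>1 = Zero C X Y \<and> p\<^sub>1 \<cdot>\<^bsub>C\<^esub> i\<^sub>2 = Zero C Y X \<and>
     Plus C (i\<^sub>1 \<cdot>\<^bsub>C\<^esub> p\<^sub>1) (i\<^sub>2 \<cdot>\<^bsub>C\<^esub> p\<^sub>2) = Ident C S"

definition is_kernel :: "('o, 'm) cat \<Rightarrow> 'm \<Rightarrow> 'm \<Rightarrow> bool" where
  "is_kernel C k f \<longleftrightarrow> f \<in> Ar C \<and> k \<in> Ar C \<and> Cod C k = Dom C f \<and>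
     f \<cdot>\<^bsub>C\<^esub> k = Zero C (Dom C k) (Cod C f) \<and>
     (\<forall>W. \<forall>t \<in> Hom C W (Dom C f). f \<cdot>\<^bsub>C\<^esub> t = Zero C W (Cod C f) \<longrightarrow>
        (\<exists>!u. u \<in> Hom C W (Dom C k) \<and> k \<cdot>\<^bsub>C\<^esub> u = t))"

definition is_cokernel :: "('o, 'm) cat \<Rightarrow> 'm \<Rightarrow> 'm \<Rightarrow> bool" where
  "is_cokernel C c f \<longleftrightarrow> f \<in> Ar C \<and> c \<in> Ar C \<and> Dom C c = Cod C f \<and>
     c \<cdot>\<^bsub>C\<^esub> f = Zero C (Dom C f) (Cod C c) \<and>
     (\<forall>W. \<forall>t \<in> Hom C (Cod C f) W. t \<cdot>\<^bsub>C\<^esub> f = Zero C (Dom C f) W \<longrightarrow>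
        (\<exists>!u. u \<in> Hom C (Cod C c) W \<and> u \<cdot>\<^bsub>C\<^esub> c = t))"

locale abelian_category = preadditive_category C for C :: "('o, 'm) cat" (structure) +
  assumes ex_zero_ob: "\<exists>Z. zero_ob C Z"
    and ex_biproduct: "\<lbrakk>X \<in> Ob C; Y \<in> Ob C\<rbrakk> \<Longrightarrow> \<exists>S i\<^sub>1 i\<^sub>2 p\<^sub>1 p\<^sub>2. is_biproduct C X Y S i\<^sub>1 i\<^sub>2 p\<^sub>1 p\<^sub>2"
    and ex_kernel: "f \<in> Ar C \<Longrightarrow> \<exists>k. is_kernel C k f"
    and ex_cokernel: "f \<in> Ar C \<Longrightarrow> \<exists>c. is_cokernel C c f"
    and mono_is_kernel: "mono_ar C f \<Longrightarrow> \<exists>g. is_kernel C f g"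
    and epi_is_cokernel: "epi_ar C f \<Longrightarrow> \<exists>g. is_cokernel C f g"

text \<open>
  Exactness of \<open>X \<rightarrow> Y \<rightarrow> Z\<close> at \<open>Y\<close>: the image of \<open>f\<close>, that is, the kernel \<open>k\<close> of a cokernel
  \<open>c\<close> of \<open>f\<close>, is a kernel of \<open>g\<close>.
\<close>

definition exact_at :: "('o, 'm) cat \<Rightarrow> 'm \<Rightarrow> 'm \<Rightarrow> bool" where
  "exact_at C f g \<longleftrightarrow> f \<in> Ar C \<and> g \<in> Ar C \<and> Cod C f = Dom C g \<and>
     (\<exists>c k. is_cokernel C c f \<and> is_kernel C k c \<and> is_kernel C k g)"

definition short_exact :: "('o, 'm) cat \<Rightarrow> 'm \<Rightarrow> 'm \<Rightarrow> bool" where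
  "short_exact C f g \<longleftrightarrow> mono_ar C f \<and> exact_at C f g \<and> epi_ar C g"


section \<open>Functors\<close>

record ('o1, 'm1, 'o2, 'm2) cfunctor =
  OMap :: "'o1 \<Rightarrow> 'o2"
  AMap :: "'m1 \<Rightarrow> 'm2"

definition id_functor :: "('o, 'm, 'o, 'm) cfunctor" where
  "id_functor = \<lparr>OMap = (\<lambda>X. X), AMap = (\<lambda>f. f)\<rparr>"

definition comp_functor ::
    "('o2, 'm2, 'o3, 'm3) cfunctor \<Rightarrow> ('o1, 'm1, 'o2, 'm2) cfunctor \<Rightarrow> ('o1, 'm1, 'o3, 'm3) cfunctor"
    (infixr "\<circ>\<^sub>F" 70) where
  "S \<circ>\<^sub>F T = \<lparr>OMap = (\<lambda>X. OMap S (OMap T X)), AMap = (\<lambda>f. AMap S (AMap T f))\<rparr>"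

locale is_functor = source: category C + target: category D
  for C :: "('o1, 'm1) cat" and D :: "('o2, 'm2) cat" and T :: "('o1, 'm1, 'o2, 'm2) cfunctor" +
  assumes omap_in: "X \<in> Ob C \<Longrightarrow> OMap T X \<in> Ob D"
    and amap_in: "f \<in> Hom C X Y \<Longrightarrow> AMap T f \<in> Hom D (OMap T X) (OMap T Y)"
    and amap_ident: "X \<in> Ob C \<Longrightarrow> AMap T (Ident C X) = Ident D (OMap T X)"
    and amap_comp: "\<lbrakk>f \<in> Hom C X Y; g \<in> Hom C Y Z\<rbrakk> \<Longrightarrow>
      AMap T (g \<cdot>\<^bsub>C\<^esub> f) = AMap T g \<cdot>\<^bsub>D\<^esub> AMap T f"

definition faithful :: "('o1, 'm1) cat \<Rightarrow> ('o1, 'm1, 'o2, 'm2) cfunctor \<Rightarrow> bool" where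
  "faithful C T \<longleftrightarrow> (\<forall>X \<in> Ob C. \<forall>Y \<in> Ob C. inj_on (AMap T) (Hom C X Y))"

definition additive_functor ::
    "('o1, 'm1) cat \<Rightarrow> ('o2, 'm2) cat \<Rightarrow> ('o1, 'm1, 'o2, 'm2) cfunctor \<Rightarrow> bool" where
  "additive_functor C D T \<longleftrightarrow> is_functor C D T \<and>
     (\<forall>X \<in> Ob C. \<forall>Y \<in> Ob C. AMap T \<in> hom (hom_group C X Y) (hom_group D (OMap T X) (OMap T Y)))"

definition exact_functor ::
    "('o1, 'm1) cat \<Rightarrow> ('o2, 'm2) cat \<Rightarrow> ('o1, 'm1, 'o2, 'm2) cfunctor \<Rightarrow> bool" where
  "exact_functor C D T \<longleftrightarrow> additive_functor C D T \<and>
     (\<forall>f g. short_exact C f g \<longrightarrow> short_exact D (AMap T f) (AMap T g))"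

definition preserves_coproducts ::
    "'u itself \<Rightarrow> ('o1, 'm1) cat \<Rightarrow> ('o2, 'm2) cat \<Rightarrow> ('o1, 'm1, 'o2, 'm2) cfunctor \<Rightarrow> bool" where
  "preserves_coproducts U C D T \<longleftrightarrow>
     (\<forall>(I :: 'u set) X S \<iota>. small I \<and> is_coproduct C I X S \<iota> \<longrightarrow>
        is_coproduct D I (\<lambda>j. OMap T (X j)) (OMap T S) (\<lambda>j. AMap T (\<iota> j)))"

definition nat_trans ::
    "('o1, 'm1) cat \<Rightarrow> ('o2, 'm2) cat \<Rightarrow> ('o1, 'm1, 'o2, 'm2) cfunctor \<Rightarrow>
     ('o1, 'm1, 'o2, 'm2) cfunctor \<Rightarrow> ('o1 \<Rightarrow> 'm2) \<Rightarrow> bool" where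
  "nat_trans C D S T \<tau> \<longleftrightarrow> is_functor C D S \<and> is_functor C D T \<and>
     (\<forall>X \<in> Ob C. \<tau> X \<in> Hom D (OMap S X) (OMap T X)) \<and>
     (\<forall>X Y. \<forall>f \<in> Hom C X Y. \<tau> Y \<cdot>\<^bsub>D\<^esub> AMap S f = AMap T f \<cdot>\<^bsub>D\<^esub> \<tau> X)"

definition nat_iso ::
    "('o1, 'm1) cat \<Rightarrow> ('o2, 'm2) cat \<Rightarrow> ('o1, 'm1, 'o2, 'm2) cfunctor \<Rightarrow>
     ('o1, 'm1, 'o2, 'm2) cfunctor \<Rightarrow> ('o1 \<Rightarrow> 'm2) \<Rightarrow> bool" where
  "nat_iso C D S T \<tau> \<longleftrightarrow> nat_trans C D S T \<tau> \<and> (\<forall>X \<in> Ob C. iso_ar D (\<tau> X))"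

text \<open>
  \<open>l : B \<rightarrow> A\<close> is left adjoint to \<open>e : A \<rightarrow> B\<close> with unit \<open>\<eta>\<close> and counit \<open>\<mu>\<close>.
\<close>

definition adjunction ::
    "('bo, 'bm) cat \<Rightarrow> ('ao, 'am) cat \<Rightarrow> ('bo, 'bm, 'ao, 'am) cfunctor \<Rightarrow>
     ('ao, 'am, 'bo, 'bm) cfunctor \<Rightarrow> ('bo \<Rightarrow> 'bm) \<Rightarrow> ('ao \<Rightarrow> 'am) \<Rightarrow> bool" where
  "adjunction B A l e \<eta> \<mu> \<longleftrightarrow> is_functor B A l \<and> is_functor A B e \<and>
     nat_trans B B id_functor (e \<circ>\<^sub>F l) \<eta> \<and> nat_trans A A (l \<circ>\<^sub>F e) id_functor \<mu> \<and>
     (\<forall>X \<in> Ob B. \<mu> (OMap l X) \<cdot>\<^bsub>A\<^esub> AMap l (\<eta> X) = Ident A (OMap l X)) \<and>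
     (\<forall>Y \<in> Ob A. AMap e (\<mu> Y) \<cdot>\<^bsub>B\<^esub> \<eta> (OMap e Y) = Ident B (OMap e Y))"


section \<open>Cleft extensions\<close>

definition cleft_extension ::
    "('bo, 'bm) cat \<Rightarrow> ('ao, 'am) cat \<Rightarrow> ('bo, 'bm, 'ao, 'am) cfunctor \<Rightarrow>
     ('ao, 'am, 'bo, 'bm) cfunctor \<Rightarrow> ('bo, 'bm, 'ao, 'am) cfunctor \<Rightarrow> bool" where
  "cleft_extension B A i e l \<longleftrightarrow> abelian_category B \<and> abelian_category A \<and>
     is_functor B A i \<and> is_functor A B e \<and> is_functor B A l \<and>
     faithful A e \<and> exact_functor A B e \<and>
     (\<exists>\<eta> \<mu>. adjunction B A l e \<eta> \<mu>) \<and>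
     (\<exists>\<theta>. nat_iso B B (e \<circ>\<^sub>F i) id_functor \<theta>)"

definition ker :: "('o, 'm) cat \<Rightarrow> 'm \<Rightarrow> 'm" where
  "ker C f = (SOME k. is_kernel C k f)"

text \<open>
  The functor \<open>G\<close> with \<open>G X = ker (\<mu> X)\<close> for a natural transformation \<open>\<mu> : T \<rightarrow> Id\<close>; on a morphism
  \<open>f : X \<rightarrow> Y\<close> it is the map \<open>ker (\<mu> X) \<rightarrow> ker (\<mu> Y)\<close> induced by \<open>T f\<close>.
\<close>

definition kernel_functor ::
    "('o, 'm) cat \<Rightarrow> ('o, 'm, 'o, 'm) cfunctor \<Rightarrow> ('o \<Rightarrow> 'm) \<Rightarrow> ('o, 'm, 'o, 'm) cfunctor" where
  "kernel_functor C T \<mu> =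
     \<lparr>OMap = (\<lambda>X. Dom C (ker C (\<mu> X))),
      AMap = (\<lambda>f. THE h.
        h \<in> Hom C (Dom C (ker C (\<mu> (Dom C f)))) (Dom C (ker C (\<mu> (Cod C f)))) \<and>
        ker C (\<mu> (Cod C f)) \<cdot>\<^bsub>C\<^esub> h = AMap T f \<cdot>\<^bsub>C\<^esub> ker C (\<mu> (Dom C f)))\<rparr>"

definition cleft_endofunctor ::
    "('ao, 'am) cat \<Rightarrow> ('bo, 'bm, 'ao, 'am) cfunctor \<Rightarrow> ('ao, 'am, 'bo, 'bm) cfunctor \<Rightarrow>
     ('bo, 'bm, 'ao, 'am) cfunctor \<Rightarrow> ('ao \<Rightarrow> 'am) \<Rightarrow> ('bo, 'bm, 'bo, 'bm) cfunctor" where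
  "cleft_endofunctor A i e l \<mu> = e \<circ>\<^sub>F kernel_functor A (l \<circ>\<^sub>F e) \<mu> \<circ>\<^sub>F i"


section \<open>Silting objects\<close>

definition D_class :: "('o, 'm) cat \<Rightarrow> 'm \<Rightarrow> 'o set" where
  "D_class C \<sigma> =
     {L \<in> Ob C. (\<lambda>g. g \<cdot>\<^bsub>C\<^esub> \<sigma>) ` Hom C (Cod C \<sigma>) L = Hom C (Dom C \<sigma>) L}"

definition Gen :: "'u itself \<Rightarrow> ('o, 'm) cat \<Rightarrow> 'o \<Rightarrow> 'o set" where
  "Gen U C X =
     {Y \<in> Ob C. \<exists>(I :: 'u set) S \<iota> f. small I \<and> is_coproduct C I (\<lambda>_. X) S \<iota> \<and>
        f \<in> Hom C S Y \<and> epi_ar C f}"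

definition torsion_class :: "'u itself \<Rightarrow> ('o, 'm) cat \<Rightarrow> 'o set \<Rightarrow> bool" where
  "torsion_class U C \<T> \<longleftrightarrow> \<T> \<subseteq> Ob C \<and>
     (\<forall>f. epi_ar C f \<and> Dom C f \<in> \<T> \<longrightarrow> Cod C f \<in> \<T>) \<and>
     (\<forall>f g. short_exact C f g \<and> Dom C f \<in> \<T> \<and> Cod C g \<in> \<T> \<longrightarrow> Cod C f \<in> \<T>) \<and>
     (\<forall>(I :: 'u set) X S \<iota>. small I \<and> (\<forall>j \<in> I. X j \<in> \<T>) \<and> is_coproduct C I X S \<iota> \<longrightarrow> S \<in> \<T>)"

text \<open>The sequence \<open>P\<^sub>1 \<rightarrow> P\<^sub>0 \<rightarrow> X \<rightarrow> 0\<close>, with maps \<open>\<sigma>\<close> and \<open>p\<close>, is a projective presentation of \<open>X\<close>.\<close>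

definition projective_presentation :: "('o, 'm) cat \<Rightarrow> 'm \<Rightarrow> 'm \<Rightarrow> 'o \<Rightarrow> bool" where
  "projective_presentation C \<sigma> p X \<longleftrightarrow>
     projective_ob C (Dom C \<sigma>) \<and> projective_ob C (Cod C \<sigma>) \<and> Cod C p = X \<and>
     exact_at C \<sigma> p \<and> epi_ar C p"

definition partial_silting :: "'u itself \<Rightarrow> ('o, 'm) cat \<Rightarrow> 'm \<Rightarrow> 'o \<Rightarrow> bool" where
  "partial_silting U C \<sigma> X \<longleftrightarrow> (\<exists>p. projective_presentation C \<sigma> p X) \<and>
     X \<in> D_class C \<sigma> \<and> torsion_class U C (D_class C \<sigma>)"

definition silting :: "'u itself \<Rightarrow> ('o, 'm) cat \<Rightarrow> 'm \<Rightarrow> 'o \<Rightarrow> bool" where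
  "silting U C \<sigma> X \<longleftrightarrow> (\<exists>p. projective_presentation C \<sigma> p X) \<and> Gen U C X = D_class C \<sigma>"

end

(*
  By adjunction, an object L lies in D_(l sigma) iff e L lies in D_sigma. The class D_sigma is closed
  under quotients and extensions because P_1 and P_0 are projective, and e l e i X is a split
  extension of e i X = X by F X with quotient map e (mu (i X)), so l X lies in D_(l sigma) iff X and
  F X lie in D_sigma. Closure under coproducts moves between the two classes along e and i, which
  settles the partial silting case. For the silting case, Gen X is the class of targets of small
  jointly epic families of morphisms from X. If a family X -> e L is jointly epic, then so is its
  transpose l X -> L, since e is faithful; and the transpose of a jointly epic family l X -> i Y is
  a jointly epic family X -> e i Y = Y, because u and v on Y are separated by i u and i v.
*)
theory Submission
  imports Defs
begin

section \<open>Preadditive and abelian categories\<close>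

text \<open>\<open>Gen\<close> is handled through jointly epic families because these cross the
  adjunction one morphism at a time, with no comparison of a coproduct of copies of \<open>X\<close>
  with one of copies of \<open>l X\<close>. Only the passage along \<open>e\<close> keeps the
  coproduct, and there the preservation of coproducts by \<open>e\<close> enters. Two jointly epic
  families compose to one indexed by pairs; infinity and regularity of the cardinal of
  \<open>'u\<close> keep that index set small. The resulting transitivity of \<open>Gen\<close>
  yields one inclusion of the silting case: for \<open>L\<close> in \<open>Gen (l X)\<close>, the
  object \<open>e L\<close> is generated by \<open>e l X\<close>, and \<open>e l X\<close> is
  generated by \<open>X\<close> as soon as \<open>X\<close> and \<open>F X\<close> lie in D_sigma =
  \<open>Gen X\<close>. Under this last equality the conditions on \<open>F X\<close> in the two
  parts of the theorem coincide.\<close>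

lemma Hom_D: "f \<in> Hom C X Y \<Longrightarrow> f \<in> Ar C \<and> Dom C f = X \<and> Cod C f = Y"
  by (simp add: Hom_def)

lemma Ar_Hom: "f \<in> Ar C \<Longrightarrow> f \<in> Hom C (Dom C f) (Cod C f)"
  by (simp add: Hom_def)

context category
begin

lemma Hom_ob: "f \<in> Hom C X Y \<Longrightarrow> X \<in> Ob C \<and> Y \<in> Ob C"
  using dom_in cod_in by (auto simp: Hom_def)

lemma epi_arI:
  assumes "f \<in> Hom C X Y"
    and "\<And>W g h. \<lbrakk>g \<in> Hom C Y W; h \<in> Hom C Y W; g \<cdot> f = h \<cdot> f\<rbrakk> \<Longrightarrow> g = h"
  shows "epi_ar C f"
  using assms Hom_D[OF assms(1)] unfolding epi_ar_def by metis

lemma epi_arD: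
  "\<lbrakk>epi_ar C f; f \<in> Hom C X Y; g \<in> Hom C Y W; h \<in> Hom C Y W; g \<cdot> f = h \<cdot> f\<rbrakk> \<Longrightarrow> g = h"
  using Hom_D[of f C X Y] unfolding epi_ar_def by metis

lemma mono_arD:
  "\<lbrakk>mono_ar C f; f \<in> Hom C X Y; g \<in> Hom C W X; h \<in> Hom C W X; f \<cdot> g = f \<cdot> h\<rbrakk> \<Longrightarrow> g = h"
  using Hom_D[of f C X Y] unfolding mono_ar_def by metis

lemma split_epi_epi:
  assumes f: "f \<in> Hom C X Y" and s: "s \<in> Hom C Y X" and fs: "f \<cdot> s = Ident C Y"
  shows "epi_ar C f"
proof (rule epi_arI[OF f])
  fix W g h assume g: "g \<in> Hom C Y W" and h: "h \<in> Hom C Y W" and eq: "g \<cdot> f = h \<cdot> f"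
  have "(g \<cdot> f) \<cdot> s = (h \<cdot> f) \<cdot> s" by (simp add: eq)
  then show "g = h"
    using comp_assoc[OF s f g] comp_assoc[OF s f h] fs comp_ident[OF g] comp_ident[OF h] by metis
qed

end

context preadditive_category
begin

text \<open>These are group laws of \<open>hom_group\<close>, rewritten from its multiplicative
  notation to \<open>Plus\<close> and \<open>Zero\<close>. A \<open>cat\<close> has no negation
  field, so subtraction takes the form of the existence statement \<open>ex_minus\<close>.\<close>

lemma
  assumes "X \<in> Ob C" and "Y \<in> Ob C"
  shows zero_in: "Zero C X Y \<in> Hom C X Y"
    and zero_plus: "f \<in> Hom C X Y \<Longrightarrow> Plus C (Zero C X Y) f = f"
    and plus_cancel: "\<lbrakk>f \<in> Hom C X Y; g \<in> Hom C X Y; Plus C f g = g\<rbrakk> \<Longrightarrow> f = Zero C X Y"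
    and ex_minus: "\<lbrakk>f \<in> Hom C X Y; g \<in> Hom C X Y\<rbrakk> \<Longrightarrow> \<exists>d \<in> Hom C X Y. Plus C d g = f"
proof -
  interpret comm_group "hom_group C X Y" by (rule hom_comm_group[OF assms])
  have simps: "carrier (hom_group C X Y) = Hom C X Y" "monoid.mult (hom_group C X Y) = Plus C"
    "one (hom_group C X Y) = Zero C X Y"
    by (auto simp: hom_group_def)
  show "Zero C X Y \<in> Hom C X Y" using one_closed by (simp only: simps)
  show "f \<in> Hom C X Y \<Longrightarrow> Plus C (Zero C X Y) f = f"
    using l_one[of f] by (simp only: simps)
  show "\<lbrakk>f \<in> Hom C X Y; g \<in> Hom C X Y; Plus C f g = g\<rbrakk> \<Longrightarrow> f = Zero C X Y"
    using r_cancel_one[of g f] unfolding simps by blast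
  show "\<lbrakk>f \<in> Hom C X Y; g \<in> Hom C X Y\<rbrakk> \<Longrightarrow> \<exists>d \<in> Hom C X Y. Plus C d g = f"
    using m_assoc[of f "inv\<^bsub>hom_group C X Y\<^esub> g" g] l_inv[of g] r_one[of f]
      inv_closed[of g] m_closed[of f "inv\<^bsub>hom_group C X Y\<^esub> g"]
    unfolding simps by (metis (no_types))
qed

text \<open>By bilinearity the composite equals its own double, and in a group only zero does. The
  same argument gives \<open>zero_comp\<close>.\<close>

lemma comp_zero:
  assumes g: "g \<in> Hom C Y Z" and X: "X \<in> Ob C"
  shows "g \<cdot> Zero C X Y = Zero C X Z"
proof -
  have Y: "Y \<in> Ob C" and Z: "Z \<in> Ob C" using Hom_ob[OF g] by auto
  have 0: "Zero C X Y \<in> Hom C X Y" by (rule zero_in[OF X Y])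
  have "Plus C (g \<cdot> Zero C X Y) (g \<cdot> Zero C X Y) = g \<cdot> Zero C X Y"
    using comp_plus[OF 0 0 g] zero_plus[OF X Y 0] by simp
  then show ?thesis using plus_cancel[OF X Z] comp_in[OF 0 g] by blast
qed

lemma zero_comp:
  assumes f: "f \<in> Hom C X Y" and Z: "Z \<in> Ob C"
  shows "Zero C Y Z \<cdot> f = Zero C X Z"
proof -
  have X: "X \<in> Ob C" and Y: "Y \<in> Ob C" using Hom_ob[OF f] by auto
  have 0: "Zero C Y Z \<in> Hom C Y Z" by (rule zero_in[OF Y Z])
  have "Plus C (Zero C Y Z \<cdot> f) (Zero C Y Z \<cdot> f) = Zero C Y Z \<cdot> f"
    using plus_comp[OF f 0 0] zero_plus[OF Y Z 0] by simp
  then show ?thesis using plus_cancel[OF X Z] comp_in[OF f 0] by blast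
qed

lemma is_kernelD:
  assumes "is_kernel C k f" and "f \<in> Hom C X Y"
  shows "k \<in> Hom C (Dom C k) X" and "f \<cdot> k = Zero C (Dom C k) Y"
    and "\<lbrakk>t \<in> Hom C W X; f \<cdot> t = Zero C W Y\<rbrakk> \<Longrightarrow>
      \<exists>!u. u \<in> Hom C W (Dom C k) \<and> k \<cdot> u = t"
proof -
  have eqs: "Dom C f = X" "Cod C f = Y" using Hom_D[OF assms(2)] by auto
  note d = assms(1)[unfolded is_kernel_def eqs]
  show "k \<in> Hom C (Dom C k) X" using d by (simp add: Hom_def)
  show "f \<cdot> k = Zero C (Dom C k) Y" using d by blast
  show "\<lbrakk>t \<in> Hom C W X; f \<cdot> t = Zero C W Y\<rbrakk> \<Longrightarrow>
      \<exists>!u. u \<in> Hom C W (Dom C k) \<and> k \<cdot> u = t"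
    using d by blast
qed

lemma is_cokernelD:
  assumes "is_cokernel C c f" and "f \<in> Hom C X Y"
  shows "c \<in> Hom C Y (Cod C c)" and "c \<cdot> f = Zero C X (Cod C c)"
    and "\<lbrakk>t \<in> Hom C Y W; t \<cdot> f = Zero C X W\<rbrakk> \<Longrightarrow>
      \<exists>!u. u \<in> Hom C (Cod C c) W \<and> u \<cdot> c = t"
proof -
  have eqs: "Dom C f = X" "Cod C f = Y" using Hom_D[OF assms(2)] by auto
  note d = assms(1)[unfolded is_cokernel_def eqs]
  show "c \<in> Hom C Y (Cod C c)" using d by (simp add: Hom_def)
  show "c \<cdot> f = Zero C X (Cod C c)" using d by blast
  show "\<lbrakk>t \<in> Hom C Y W; t \<cdot> f = Zero C X W\<rbrakk> \<Longrightarrow>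
      \<exists>!u. u \<in> Hom C (Cod C c) W \<and> u \<cdot> c = t"
    using d by blast
qed

text \<open>Uniqueness of the factorisation is exactly that \<open>k\<close> is monic, so only
  existence is left to check.\<close>

lemma is_kernelI:
  assumes "f \<in> Hom C X Y" and "k \<in> Hom C K X" and "f \<cdot> k = Zero C K Y"
    and "mono_ar C k"
    and "\<And>W t. \<lbrakk>t \<in> Hom C W X; f \<cdot> t = Zero C W Y\<rbrakk> \<Longrightarrow> \<exists>u \<in> Hom C W K. k \<cdot> u = t"
  shows "is_kernel C k f"
proof -
  have "\<exists>!u. u \<in> Hom C W K \<and> k \<cdot> u = t" if "t \<in> Hom C W X" "f \<cdot> t = Zero C W Y" for W t
    using assms(5)[OF that] mono_arD[OF assms(4,2)] by metis
  then show ?thesis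
    using Hom_D[OF assms(1)] Hom_D[OF assms(2)] assms(3) unfolding is_kernel_def by simp
qed

lemma is_cokernelI:
  assumes "f \<in> Hom C X Y" and "c \<in> Hom C Y Q" and "c \<cdot> f = Zero C X Q"
    and "epi_ar C c"
    and "\<And>W t. \<lbrakk>t \<in> Hom C Y W; t \<cdot> f = Zero C X W\<rbrakk> \<Longrightarrow> \<exists>u \<in> Hom C Q W. u \<cdot> c = t"
  shows "is_cokernel C c f"
proof -
  have "\<exists>!u. u \<in> Hom C Q W \<and> u \<cdot> c = t" if "t \<in> Hom C Y W" "t \<cdot> f = Zero C X W" for W t
    using assms(5)[OF that] epi_arD[OF assms(4,2)] by metis
  then show ?thesis
    using Hom_D[OF assms(1)] Hom_D[OF assms(2)] assms(3) unfolding is_cokernel_def by simp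
qed

lemma kernel_mono:
  assumes "is_kernel C k f"
  shows "mono_ar C k"
  unfolding mono_ar_def
proof (intro conjI allI ballI impI)
  show "k \<in> Ar C" using assms by (simp add: is_kernel_def)
  have f: "f \<in> Hom C (Dom C f) (Cod C f)" using assms by (simp add: is_kernel_def Hom_def)
  have k: "k \<in> Hom C (Dom C k) (Dom C f)" by (rule is_kernelD(1)[OF assms f])
  fix W g h assume g: "g \<in> Hom C W (Dom C k)" and h: "h \<in> Hom C W (Dom C k)"
    and eq: "k \<cdot> g = k \<cdot> h"
  have "f \<cdot> (k \<cdot> g) = Zero C W (Cod C f)"
    using comp_assoc[OF g k f] is_kernelD(2)[OF assms f] zero_comp[OF g] Hom_ob[OF f] by simp
  from is_kernelD(3)[OF assms f comp_in[OF g k] this] show "g = h" using g h eq by metis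
qed

lemma cokernel_epi:
  assumes "is_cokernel C c f"
  shows "epi_ar C c"
  unfolding epi_ar_def
proof (intro conjI allI ballI impI)
  show "c \<in> Ar C" using assms by (simp add: is_cokernel_def)
  have f: "f \<in> Hom C (Dom C f) (Cod C f)" using assms by (simp add: is_cokernel_def Hom_def)
  have c: "c \<in> Hom C (Cod C f) (Cod C c)" by (rule is_cokernelD(1)[OF assms f])
  fix W g h assume g: "g \<in> Hom C (Cod C c) W" and h: "h \<in> Hom C (Cod C c) W"
    and eq: "g \<cdot> c = h \<cdot> c"
  have "(g \<cdot> c) \<cdot> f = Zero C (Dom C f) W"
    using comp_assoc[OF f c g] is_cokernelD(2)[OF assms f] comp_zero[OF g] Hom_ob[OF f] by simp
  from is_cokernelD(3)[OF assms f comp_in[OF c g] this] show "g = h" using g h eq by metis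
qed

text \<open>The morphism 1 - s f is killed by \<open>f\<close>, so it factors as \<open>k t\<close>.
  Since s f k = 0, it follows that k t k = k, and cancelling the mono \<open>k\<close> leaves t k =
  1.\<close>

lemma kernel_split_retraction:
  assumes k: "is_kernel C k f" and f: "f \<in> Hom C X Y" and s: "s \<in> Hom C Y X"
    and fs: "f \<cdot> s = Ident C Y"
  shows "\<exists>t \<in> Hom C X (Dom C k). t \<cdot> k = Ident C (Dom C k)"
proof -
  note kH = is_kernelD(1)[OF k f]
  have ob: "X \<in> Ob C" "Y \<in> Ob C" "Dom C k \<in> Ob C" using Hom_ob[OF f] Hom_ob[OF kH] by auto
  have sf: "s \<cdot> f \<in> Hom C X X" by (rule comp_in[OF f s])
  obtain d where d: "d \<in> Hom C X X" and dsf: "Plus C d (s \<cdot> f) = Ident C X"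
    using ex_minus[OF ob(1,1) ident_in[OF ob(1)] sf] by blast
  have fsf: "f \<cdot> (s \<cdot> f) = f" using comp_assoc[OF f s f] fs ident_comp[OF f] by simp
  have "Plus C (f \<cdot> d) f = f"
    using comp_plus[OF d sf f] dsf fsf comp_ident[OF f] by simp
  then have "f \<cdot> d = Zero C X Y" by (rule plus_cancel[OF ob(1,2) comp_in[OF d f] f])
  then obtain t where t: "t \<in> Hom C X (Dom C k)" and kt: "k \<cdot> t = d"
    using is_kernelD(3)[OF k f d] by blast
  have "(s \<cdot> f) \<cdot> k = Zero C (Dom C k) X"
    using comp_assoc[OF kH f s] is_kernelD(2)[OF k f] comp_zero[OF s ob(3)] by simp
  then have "Plus C (d \<cdot> k) (Zero C (Dom C k) X) = k"
    using plus_comp[OF kH d sf] dsf ident_comp[OF kH] by simp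
  moreover have "Plus C (d \<cdot> k) (Zero C (Dom C k) X) = d \<cdot> k"
  proof -
    interpret comm_group "hom_group C (Dom C k) X" by (rule hom_comm_group[OF ob(3,1)])
    show ?thesis using r_one[of "d \<cdot> k"] comp_in[OF kH d] by (simp add: hom_group_def)
  qed
  ultimately have "k \<cdot> (t \<cdot> k) = k \<cdot> Ident C (Dom C k)"
    using comp_assoc[OF kH t kH] kt comp_ident[OF kH] by simp
  then have "t \<cdot> k = Ident C (Dom C k)"
    by (rule mono_arD[OF kernel_mono[OF k] kH comp_in[OF kH t] ident_in[OF ob(3)]])
  then show ?thesis using t by blast
qed

end

section \<open>Monos, epis and exactness in terms of kernels and cokernels\<close>

context abelian_category
begin

text \<open>Some \<open>h\<close> has \<open>g\<close> as cokernel. As g h = 0, \<open>h\<close>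
  factors through \<open>k\<close>, so every map that kills \<open>k\<close> kills \<open>h\<close>
  and hence factors through \<open>g\<close>.\<close>

lemma epi_cokernel_of_kernel:
  assumes g: "epi_ar C g" and k: "is_kernel C k g"
  shows "is_cokernel C g k"
proof -
  obtain h where h: "is_cokernel C g h" using epi_is_cokernel[OF g] by blast
  have gH: "g \<in> Hom C (Dom C g) (Cod C g)" using g by (simp add: epi_ar_def Hom_def)
  have hH: "h \<in> Hom C (Dom C h) (Dom C g)" using h by (auto simp: is_cokernel_def Hom_def)
  note kH = is_kernelD(1)[OF k gH]
  obtain u where u: "u \<in> Hom C (Dom C h) (Dom C k)" and ku: "k \<cdot> u = h"
    using is_kernelD(3)[OF k gH hH] is_cokernelD(2)[OF h hH] by blast
  show ?thesis
  proof (rule is_cokernelI[OF kH gH is_kernelD(2)[OF k gH] g])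
    fix W t assume t: "t \<in> Hom C (Dom C g) W" and tk: "t \<cdot> k = Zero C (Dom C k) W"
    have "t \<cdot> h = Zero C (Dom C h) W"
      using comp_assoc[OF u kH t] ku tk zero_comp[OF u] Hom_ob[OF t] by simp
    then show "\<exists>u \<in> Hom C (Cod C g) W. u \<cdot> g = t"
      using is_cokernelD(3)[OF h hH t] by blast
  qed
qed

lemma mono_kernel_of_cokernel:
  assumes f: "mono_ar C f" and c: "is_cokernel C c f"
  shows "is_kernel C f c"
proof -
  obtain h where h: "is_kernel C f h" using mono_is_kernel[OF f] by blast
  have fH: "f \<in> Hom C (Dom C f) (Cod C f)" using f by (simp add: mono_ar_def Hom_def)
  have hH: "h \<in> Hom C (Cod C f) (Cod C h)" using h by (auto simp: is_kernel_def Hom_def)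
  note cH = is_cokernelD(1)[OF c fH]
  obtain u where u: "u \<in> Hom C (Cod C c) (Cod C h)" and uc: "u \<cdot> c = h"
    using is_cokernelD(3)[OF c fH hH] is_kernelD(2)[OF h hH] by blast
  show ?thesis
  proof (rule is_kernelI[OF cH fH is_cokernelD(2)[OF c fH] f])
    fix W t assume t: "t \<in> Hom C W (Cod C f)" and ct: "c \<cdot> t = Zero C W (Cod C c)"
    have "h \<cdot> t = Zero C W (Cod C h)"
      using comp_assoc[OF t cH u] uc ct comp_zero[OF u] Hom_ob[OF t] by simp
    then show "\<exists>u \<in> Hom C W (Dom C f). f \<cdot> u = t"
      using is_kernelD(3)[OF h hH t] by blast
  qed
qed

lemma short_exact_of_kernel:
  assumes "epi_ar C g" and "is_kernel C k g"
  shows "short_exact C k g"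
  using epi_cokernel_of_kernel[OF assms] kernel_mono[OF assms(2)] assms
  unfolding short_exact_def exact_at_def by (auto simp: is_kernel_def)

text \<open>The cokernel \<open>c\<close> of \<open>f\<close> and the epi \<open>g\<close> have the
  kernel \<open>k\<close> in common, so both are cokernels of \<open>k\<close> and factor through
  each other. The universal property of \<open>c\<close> thereby passes to \<open>g\<close>.\<close>

lemma exact_at_epi_cokernel:
  assumes ex: "exact_at C f g" and g: "epi_ar C g"
  shows "is_cokernel C g f"
proof -
  obtain c k where c: "is_cokernel C c f" and kc: "is_kernel C k c" and kg: "is_kernel C k g"
    using ex unfolding exact_at_def by blast
  have fH: "f \<in> Hom C (Dom C f) (Dom C g)" and gH: "g \<in> Hom C (Dom C g) (Cod C g)"
    using ex by (auto simp: exact_at_def Hom_def)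
  have cH: "c \<in> Hom C (Dom C g) (Cod C c)" using is_cokernelD(1)[OF c fH] .
  have kH: "k \<in> Hom C (Dom C k) (Dom C g)" using is_kernelD(1)[OF kg gH] .
  note ck = epi_cokernel_of_kernel[OF cokernel_epi[OF c] kc] and gk = epi_cokernel_of_kernel[OF g kg]
  obtain u where u: "u \<in> Hom C (Cod C c) (Cod C g)" and uc: "u \<cdot> c = g"
    using is_cokernelD(3)[OF ck kH gH] is_cokernelD(2)[OF gk kH] by blast
  obtain v where v: "v \<in> Hom C (Cod C g) (Cod C c)" and vg: "v \<cdot> g = c"
    using is_cokernelD(3)[OF gk kH cH] is_cokernelD(2)[OF ck kH] by blast
  show ?thesis
  proof (rule is_cokernelI[OF fH gH _ g])
    show "g \<cdot> f = Zero C (Dom C f) (Cod C g)"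
      using comp_assoc[OF fH cH u] uc is_cokernelD(2)[OF c fH] comp_zero[OF u] Hom_ob[OF fH] by simp
    fix W t assume t: "t \<in> Hom C (Dom C g) W" and tf: "t \<cdot> f = Zero C (Dom C f) W"
    then obtain w where w: "w \<in> Hom C (Cod C c) W" and wc: "w \<cdot> c = t"
      using is_cokernelD(3)[OF c fH t] by blast
    have "(w \<cdot> v) \<cdot> g = t" using comp_assoc[OF gH v w] vg wc by simp
    then show "\<exists>u \<in> Hom C (Cod C g) W. u \<cdot> g = t" using comp_in[OF v w] by blast
  qed
qed

lemma cokernel_exact_at:
  assumes c: "is_cokernel C c f"
  shows "exact_at C f c"
proof -
  have "c \<in> Ar C" using c by (simp add: is_cokernel_def)
  then obtain k where "is_kernel C k c" using ex_kernel by blast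
  then show ?thesis using c unfolding exact_at_def by (auto simp: is_cokernel_def)
qed

lemma short_exact_kernel:
  assumes "short_exact C f g"
  shows "is_kernel C f g"
proof -
  have f: "mono_ar C f" and ex: "exact_at C f g" and g: "epi_ar C g"
    using assms by (auto simp: short_exact_def)
  show ?thesis by (rule mono_kernel_of_cokernel[OF f exact_at_epi_cokernel[OF ex g]])
qed

end

text \<open>Exactness is defined by short exact sequences only, so the epi is first completed to one
  by its kernel.\<close>

lemma exact_functor_epi:
  assumes T: "exact_functor C D T" and C: "abelian_category C" and g: "epi_ar C g"
  shows "epi_ar D (AMap T g)"
proof -
  have "g \<in> Ar C" using g by (simp add: epi_ar_def)
  then obtain k where "is_kernel C k g" using abelian_category.ex_kernel[OF C] by blast
  then have "short_exact C k g" by (rule abelian_category.short_exact_of_kernel[OF C g])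
  then show ?thesis using T by (auto simp: exact_functor_def short_exact_def)
qed

section \<open>The class \<open>D_class C \<sigma>\<close>\<close>

context category
begin

text \<open>Of the set equality in \<open>D_class\<close> only one inclusion has content; the other
  is closure under composition.\<close>

lemma D_class_iff:
  assumes "\<sigma> \<in> Hom C P Q"
  shows "L \<in> D_class C \<sigma> \<longleftrightarrow>
    L \<in> Ob C \<and> (\<forall>g \<in> Hom C P L. \<exists>h \<in> Hom C Q L. h \<cdot> \<sigma> = g)"
proof -
  have "Dom C \<sigma> = P" "Cod C \<sigma> = Q" using Hom_D[OF assms] by auto
  moreover have "(\<lambda>g. g \<cdot> \<sigma>) ` Hom C Q L = Hom C P L \<longleftrightarrow>
      (\<forall>g \<in> Hom C P L. \<exists>h \<in> Hom C Q L. h \<cdot> \<sigma> = g)"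
    using comp_in[OF assms] by (auto simp: set_eq_iff image_iff) metis+
  ultimately show ?thesis unfolding D_class_def by simp
qed

text \<open>Projectivity of \<open>P\<close>, the source of \<open>\<sigma>\<close>, lifts a test
  map from \<open>Y\<close> to \<open>X\<close>; it extends along \<open>\<sigma>\<close> there, and
  composing with \<open>f\<close> returns to \<open>Y\<close>.\<close>

lemma D_class_epi:
  assumes \<sigma>: "\<sigma> \<in> Hom C P Q" and P: "projective_ob C P"
    and f: "f \<in> Hom C X Y" and epi: "epi_ar C f" and X: "X \<in> D_class C \<sigma>"
  shows "Y \<in> D_class C \<sigma>"
  unfolding D_class_iff[OF \<sigma>]
proof (intro conjI ballI)
  show "Y \<in> Ob C" using Hom_ob[OF f] by blast
  fix g assume "g \<in> Hom C P Y"
  then obtain g' where g': "g' \<in> Hom C P X" and g: "f \<cdot> g' = g"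
    using P epi Hom_D[OF f] unfolding projective_ob_def by metis
  obtain h where h: "h \<in> Hom C Q X" and hg: "h \<cdot> \<sigma> = g'"
    using X g' unfolding D_class_iff[OF \<sigma>] by blast
  have "(f \<cdot> h) \<cdot> \<sigma> = g" using comp_assoc[OF \<sigma> h f] hg g by simp
  then show "\<exists>h \<in> Hom C Q Y. h \<cdot> \<sigma> = g" using comp_in[OF h f] by blast
qed

lemma iso_ar_inverse:
  assumes "iso_ar C f" and "f \<in> Hom C X Y"
  shows "\<exists>g \<in> Hom C Y X. g \<cdot> f = Ident C X \<and> f \<cdot> g = Ident C Y"
  using assms Hom_D[OF assms(2)] unfolding iso_ar_def by auto

lemma iso_epi: "\<lbrakk>iso_ar C f; f \<in> Hom C X Y\<rbrakk> \<Longrightarrow> epi_ar C f"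
  using iso_ar_inverse split_epi_epi by blast

lemma D_class_iso:
  assumes \<sigma>: "\<sigma> \<in> Hom C P Q" and P: "projective_ob C P"
    and f: "f \<in> Hom C X Y" and iso: "iso_ar C f"
  shows "X \<in> D_class C \<sigma> \<longleftrightarrow> Y \<in> D_class C \<sigma>"
proof -
  obtain g where g: "g \<in> Hom C Y X" and "g \<cdot> f = Ident C X"
    using iso_ar_inverse[OF iso f] by blast
  then have "epi_ar C g" using split_epi_epi f by blast
  then show ?thesis
    using D_class_epi[OF \<sigma> P f iso_epi[OF iso f]] D_class_epi[OF \<sigma> P g] by blast
qed

end

text \<open>A test map \<open>a\<close> into \<open>M\<close> is first extended modulo the kernel:
  the extension of \<open>g a\<close> over \<open>Q\<close> lifts to \<open>h'\<close> into
  \<open>M\<close>, because \<open>Q\<close> is projective. The error a - h' sigma is killed by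
  \<open>g\<close>, so it comes from the kernel object, where it extends too; the sum of both
  extensions restricts to \<open>a\<close>.\<close>

lemma (in abelian_category) D_class_extension:
  assumes \<sigma>: "\<sigma> \<in> Hom C P Q" and Q: "projective_ob C Q"
    and g: "g \<in> Hom C M N" and epi: "epi_ar C g" and k: "is_kernel C k g"
    and K: "Dom C k \<in> D_class C \<sigma>" and N: "N \<in> D_class C \<sigma>"
  shows "M \<in> D_class C \<sigma>"
  unfolding D_class_iff[OF \<sigma>]
proof (intro conjI ballI)
  have ob: "M \<in> Ob C" "N \<in> Ob C" "P \<in> Ob C" using Hom_ob[OF g] Hom_ob[OF \<sigma>] by auto
  show "M \<in> Ob C" by fact
  note kH = is_kernelD(1)[OF k g]
  fix a assume a: "a \<in> Hom C P M"
  obtain h where h: "h \<in> Hom C Q N" and hs: "h \<cdot> \<sigma> = g \<cdot> a"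
    using N comp_in[OF a g] unfolding D_class_iff[OF \<sigma>] by blast
  obtain h' where h': "h' \<in> Hom C Q M" and gh': "g \<cdot> h' = h"
    using Q epi h Hom_D[OF g] unfolding projective_ob_def by metis
  have hs': "h' \<cdot> \<sigma> \<in> Hom C P M" by (rule comp_in[OF \<sigma> h'])
  \<comment> \<open>\<open>d\<close> is the error a - h' sigma.\<close>
  obtain d where d: "d \<in> Hom C P M" and da: "Plus C d (h' \<cdot> \<sigma>) = a"
    using ex_minus[OF ob(3,1) a hs'] by blast
  have "Plus C (g \<cdot> d) (g \<cdot> a) = g \<cdot> a"
    using comp_plus[OF d hs' g] da comp_assoc[OF \<sigma> h' g] gh' hs by simp
  then have "g \<cdot> d = Zero C P N" by (rule plus_cancel[OF ob(3,2) comp_in[OF d g] comp_in[OF a g]])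
  then obtain b where b: "b \<in> Hom C P (Dom C k)" and kb: "k \<cdot> b = d"
    using is_kernelD(3)[OF k g d] by blast
  obtain b' where b': "b' \<in> Hom C Q (Dom C k)" and bs: "b' \<cdot> \<sigma> = b"
    using K b unfolding D_class_iff[OF \<sigma>] by blast
  note kb' = comp_in[OF b' kH]
  have "Plus C (k \<cdot> b') h' \<cdot> \<sigma> = a"
    using plus_comp[OF \<sigma> kb' h'] comp_assoc[OF \<sigma> b' kH] bs kb da by simp
  moreover have "Plus C (k \<cdot> b') h' \<in> Hom C Q M"
  proof -
    have "Q \<in> Ob C" using Hom_ob[OF \<sigma>] by blast
    then interpret comm_group "hom_group C Q M" using hom_comm_group ob(1) by blast
    show ?thesis using m_closed[of "k \<cdot> b'" h'] kb' h' by (simp add: hom_group_def)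
  qed
  ultimately show "\<exists>h \<in> Hom C Q M. h \<cdot> \<sigma> = a" by blast
qed

text \<open>Closure under quotients and extensions is automatic by the preceding lemmas, so
  coproducts are the only condition.\<close>

lemma (in abelian_category) torsion_class_D_class_iff:
  assumes \<sigma>: "\<sigma> \<in> Hom C P Q" and P: "projective_ob C P" and Q: "projective_ob C Q"
  shows "torsion_class TYPE('u) C (D_class C \<sigma>) \<longleftrightarrow>
    (\<forall>(I :: 'u set) X S \<iota>. small I \<and> (\<forall>j \<in> I. X j \<in> D_class C \<sigma>) \<and> is_coproduct C I X S \<iota> \<longrightarrow>
      S \<in> D_class C \<sigma>)"
proof -
  have "Cod C f \<in> D_class C \<sigma>" if "epi_ar C f" "Dom C f \<in> D_class C \<sigma>" for f
    using D_class_epi[OF \<sigma> P Ar_Hom] that unfolding epi_ar_def by blast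
  moreover have "Cod C f \<in> D_class C \<sigma>"
    if "short_exact C f g" "Dom C f \<in> D_class C \<sigma>" "Cod C g \<in> D_class C \<sigma>" for f g
  proof -
    have "is_kernel C f g" by (rule short_exact_kernel) fact
    moreover have "epi_ar C g" and "g \<in> Hom C (Cod C f) (Cod C g)"
      using that(1) by (auto simp: short_exact_def exact_at_def Hom_def)
    ultimately show ?thesis using D_class_extension[OF \<sigma> Q] that by blast
  qed
  moreover have "D_class C \<sigma> \<subseteq> Ob C" by (auto simp: D_class_def)
  ultimately show ?thesis unfolding torsion_class_def by blast
qed

text \<open>The splitting makes the kernel object a retract, hence also a quotient, of
  \<open>M\<close>; this turns closure under extensions into an equivalence.\<close>

lemma (in abelian_category) D_class_split_extension:
  assumes \<sigma>: "\<sigma> \<in> Hom C P Q" and P: "projective_ob C P" and Q: "projective_ob C Q"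
    and g: "g \<in> Hom C M N" and s: "s \<in> Hom C N M" and gs: "g \<cdot> s = Ident C N"
    and k: "is_kernel C k g"
  shows "M \<in> D_class C \<sigma> \<longleftrightarrow> N \<in> D_class C \<sigma> \<and> Dom C k \<in> D_class C \<sigma>"
proof -
  note kH = is_kernelD(1)[OF k g] and epi = split_epi_epi[OF g s gs]
  obtain t where t: "t \<in> Hom C M (Dom C k)" and tk: "t \<cdot> k = Ident C (Dom C k)"
    using kernel_split_retraction[OF k g s gs] by blast
  show ?thesis
    using D_class_extension[OF \<sigma> Q g epi k] D_class_epi[OF \<sigma> P g epi]
      D_class_epi[OF \<sigma> P t split_epi_epi[OF t kH tk]] by blast
qed

section \<open>Jointly epic families\<close>

text \<open>Encodes an epimorphism from a coproduct of copies of \<open>X\<close> without mentioning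
  the coproduct. For empty \<open>I\<close> it does not force \<open>Y\<close> to be an object, so
  that is stated separately where it matters.\<close>

definition jointly_epic :: "('o, 'm) cat \<Rightarrow> 'o \<Rightarrow> 'o \<Rightarrow> 'u set \<Rightarrow> ('u \<Rightarrow> 'm) \<Rightarrow> bool" where
  "jointly_epic C X Y I f \<longleftrightarrow> (\<forall>j \<in> I. f j \<in> Hom C X Y) \<and>
     (\<forall>Z. \<forall>g \<in> Hom C Y Z. \<forall>h \<in> Hom C Y Z.
        (\<forall>j \<in> I. g \<cdot>\<^bsub>C\<^esub> f j = h \<cdot>\<^bsub>C\<^esub> f j) \<longrightarrow> g = h)"

text \<open>Index sets of \<open>Gen\<close> must be subsets of \<open>'u\<close>, so pairs are
  coded by an injection \<open>b\<close> of \<open>'u \<times> 'u\<close> into \<open>'u\<close>,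
  and \<open>r\<close> decodes them.\<close>

lemma small_product_reindex:
  fixes I J :: "'u set"
  assumes inf: "infinite (UNIV :: 'u set)" and reg: "regularCard |UNIV :: 'u set|"
    and I: "small I" and J: "small J"
  shows "\<exists>K (r :: 'u \<Rightarrow> 'u \<times> 'u). small K \<and> r ` K = I \<times> J"
proof -
  have "|UNIV \<times> UNIV :: ('u \<times> 'u) set| \<le>o |UNIV :: 'u set|"
    using card_of_Times_same_infinite[OF inf] ordIso_iff_ordLeq by blast
  then obtain b :: "'u \<times> 'u \<Rightarrow> 'u" where b: "inj b"
    unfolding card_of_ordLeq[symmetric] by auto
  \<comment> \<open>A family of fewer than kappa sets, each smaller than kappa, has disjoint union
    smaller than kappa; it is applied to the constant family \<open>J\<close> over
    \<open>I\<close>.\<close>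
  have "stable |UNIV :: 'u set|"
    by (rule regularCard_stable[OF card_of_Card_order _ reg]) (simp add: inf Field_card_of)
  then have "|I \<times> J| <o |UNIV :: 'u set|"
    using I J unfolding small_def stable_def by (elim allE[of _ I] allE[of _ "\<lambda>_. J"]) blast
  then have "small (b ` (I \<times> J))"
    unfolding small_def using ordLeq_ordLess_trans[OF card_of_image] by blast
  moreover have "inv_into UNIV b ` b ` (I \<times> J) = I \<times> J" using b by (simp add: image_image)
  ultimately show ?thesis by blast
qed

context category
begin

lemma coproduct_ex1:
  assumes "is_coproduct C I X S \<iota>" and "Y \<in> Ob C" and "\<And>j. j \<in> I \<Longrightarrow> f j \<in> Hom C (X j) Y"
  shows "\<exists>!h. h \<in> Hom C S Y \<and> (\<forall>j \<in> I. h \<cdot> \<iota> j = f j)"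
  using assms unfolding is_coproduct_def by simp

lemma coproduct_ext:
  assumes S: "is_coproduct C I X S \<iota>" and g: "g \<in> Hom C S Y" and h: "h \<in> Hom C S Y"
    and eq: "\<forall>j \<in> I. g \<cdot> \<iota> j = h \<cdot> \<iota> j"
  shows "g = h"
proof -
  have "g \<cdot> \<iota> j \<in> Hom C (X j) Y" if "j \<in> I" for j
    using S g that comp_in unfolding is_coproduct_def by blast
  then have "\<exists>!u. u \<in> Hom C S Y \<and> (\<forall>j \<in> I. u \<cdot> \<iota> j = g \<cdot> \<iota> j)"
    using coproduct_ex1[OF S, of Y "\<lambda>j. g \<cdot> \<iota> j"] Hom_ob[OF g] by blast
  then show ?thesis using g h eq by metis
qed

text \<open>Morphisms out of \<open>S\<close> are determined by their composites with the
  injections, so cancelling \<open>f\<close> amounts to cancelling all its components at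
  once.\<close>

lemma epi_coproduct_jointly_epic:
  assumes S: "is_coproduct C I (\<lambda>_. X) S \<iota>" and f: "f \<in> Hom C S Y"
  shows "epi_ar C f \<longleftrightarrow> jointly_epic C X Y I (\<lambda>j. f \<cdot> \<iota> j)"
proof -
  have \<iota>: "\<iota> j \<in> Hom C X S" if "j \<in> I" for j using S that by (auto simp: is_coproduct_def)
  have "g \<cdot> f = h \<cdot> f \<longleftrightarrow> (\<forall>j \<in> I. g \<cdot> (f \<cdot> \<iota> j) = h \<cdot> (f \<cdot> \<iota> j))"
    if g: "g \<in> Hom C Y Z" and h: "h \<in> Hom C Y Z" for g h Z
  proof -
    have "g \<cdot> f = h \<cdot> f \<longleftrightarrow> (\<forall>j \<in> I. (g \<cdot> f) \<cdot> \<iota> j = (h \<cdot> f) \<cdot> \<iota> j)"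
      using coproduct_ext[OF S comp_in[OF f g] comp_in[OF f h]] by auto
    also have "\<dots> \<longleftrightarrow> (\<forall>j \<in> I. g \<cdot> (f \<cdot> \<iota> j) = h \<cdot> (f \<cdot> \<iota> j))"
      using comp_assoc[OF \<iota> f g] comp_assoc[OF \<iota> f h] by simp
    finally show ?thesis .
  qed
  then show ?thesis
    using Hom_D[OF f] comp_in[OF \<iota> f] unfolding jointly_epic_def epi_ar_def by simp
qed

lemma Gen_iff_jointly_epic:
  assumes cop: "has_coproducts TYPE('u) C" and X: "X \<in> Ob C"
  shows "Y \<in> Gen TYPE('u) C X \<longleftrightarrow>
    Y \<in> Ob C \<and> (\<exists>(I :: 'u set) f. small I \<and> jointly_epic C X Y I f)"
proof
  assume "Y \<in> Gen TYPE('u) C X"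
  then show "Y \<in> Ob C \<and> (\<exists>(I :: 'u set) f. small I \<and> jointly_epic C X Y I f)"
    unfolding Gen_def using epi_coproduct_jointly_epic by blast
next
  assume "Y \<in> Ob C \<and> (\<exists>(I :: 'u set) f. small I \<and> jointly_epic C X Y I f)"
  then obtain I :: "'u set" and f where Y: "Y \<in> Ob C" and I: "small I"
    and f: "jointly_epic C X Y I f" by blast
  obtain S \<iota> where S: "is_coproduct C I (\<lambda>_. X) S \<iota>"
    using cop[unfolded has_coproducts_def, rule_format, of I "\<lambda>_. X"] I X by blast
  have "f j \<in> Hom C X Y" if "j \<in> I" for j using f that by (simp add: jointly_epic_def)
  then obtain h where h: "h \<in> Hom C S Y" and hf: "\<forall>j \<in> I. h \<cdot> \<iota> j = f j"
    using ex1_implies_ex[OF coproduct_ex1[OF S Y, of f]] by auto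
  have "jointly_epic C X Y I (\<lambda>j. h \<cdot> \<iota> j)"
    using f hf unfolding jointly_epic_def by simp
  then have "epi_ar C h" using epi_coproduct_jointly_epic[OF S h] by blast
  then show "Y \<in> Gen TYPE('u) C X" using Y I S h unfolding Gen_def by blast
qed

text \<open>For each fixed \<open>j\<close> the inner family is cancelled first, then the outer one.
  Only surjectivity of \<open>r\<close> onto the pairs matters, since repeated members do no
  harm.\<close>

lemma jointly_epic_comp:
  assumes f: "jointly_epic C X Y I f" and g: "jointly_epic C Y Z J g" and r: "r ` K = I \<times> J"
  shows "jointly_epic C X Z K (\<lambda>k. g (snd (r k)) \<cdot> f (fst (r k)))"
  unfolding jointly_epic_def
proof (intro conjI ballI allI impI)
  have fH: "f i \<in> Hom C X Y" if "i \<in> I" for i using f that by (simp add: jointly_epic_def)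
  have gH: "g j \<in> Hom C Y Z" if "j \<in> J" for j using g that by (simp add: jointly_epic_def)
  fix k assume "k \<in> K"
  then have "r k \<in> I \<times> J" using r by blast
  then show "g (snd (r k)) \<cdot> f (fst (r k)) \<in> Hom C X Z" using comp_in[OF fH gH] by (simp add: mem_Times_iff)
next
  have fH: "f i \<in> Hom C X Y" if "i \<in> I" for i using f that by (simp add: jointly_epic_def)
  have gH: "g j \<in> Hom C Y Z" if "j \<in> J" for j using g that by (simp add: jointly_epic_def)
  fix W u v assume u: "u \<in> Hom C Z W" and v: "v \<in> Hom C Z W"
    and eq: "\<forall>k \<in> K. u \<cdot> (g (snd (r k)) \<cdot> f (fst (r k))) = v \<cdot> (g (snd (r k)) \<cdot> f (fst (r k)))"
  have "u \<cdot> g j = v \<cdot> g j" if j: "j \<in> J" for j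
  proof -
    have "(u \<cdot> g j) \<cdot> f i = (v \<cdot> g j) \<cdot> f i" if i: "i \<in> I" for i
    proof -
      obtain k where "k \<in> K" "r k = (i, j)" using r i j by (metis SigmaI imageE)
      then have "u \<cdot> (g j \<cdot> f i) = v \<cdot> (g j \<cdot> f i)" using eq by force
      then show ?thesis using comp_assoc[OF fH[OF i] gH[OF j] u] comp_assoc[OF fH[OF i] gH[OF j] v] by simp
    qed
    then show ?thesis
      using f comp_in[OF gH[OF j] u] comp_in[OF gH[OF j] v] unfolding jointly_epic_def by blast
  qed
  then show "u = v" using g u v unfolding jointly_epic_def by blast
qed

lemma epi_iff_jointly_epic:
  "f \<in> Hom C X Y \<Longrightarrow> epi_ar C f \<longleftrightarrow> jointly_epic C X Y {j} (\<lambda>_. f)"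
  using Hom_D[of f C X Y] unfolding jointly_epic_def epi_ar_def by simp

lemma Gen_trans:
  assumes inf: "infinite (UNIV :: 'u set)" and reg: "regularCard |UNIV :: 'u set|"
    and cop: "has_coproducts TYPE('u) C" and X: "X \<in> Ob C"
    and Y: "Y \<in> Gen TYPE('u) C X" and Z: "Z \<in> Gen TYPE('u) C Y"
  shows "Z \<in> Gen TYPE('u) C X"
proof -
  obtain I :: "'u set" and f where "Y \<in> Ob C" and I: "small I" and f: "jointly_epic C X Y I f"
    using Y unfolding Gen_iff_jointly_epic[OF cop X] by blast
  then obtain J :: "'u set" and g where "Z \<in> Ob C" and J: "small J" and g: "jointly_epic C Y Z J g"
    using Z Gen_iff_jointly_epic[OF cop] by blast
  obtain K and r :: "'u \<Rightarrow> 'u \<times> 'u" where "small K" and r: "r ` K = I \<times> J"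
    using small_product_reindex[OF inf reg I J] by blast
  then show ?thesis
    using jointly_epic_comp[OF f g r] \<open>Z \<in> Ob C\<close> unfolding Gen_iff_jointly_epic[OF cop X] by blast
qed

lemma Gen_epi:
  assumes inf: "infinite (UNIV :: 'u set)" and cop: "has_coproducts TYPE('u) C"
    and f: "f \<in> Hom C X Y" and epi: "epi_ar C f"
  shows "Y \<in> Gen TYPE('u) C X"
proof -
  \<comment> \<open>Any index will do: a singleton is small because the type is infinite.\<close>
  fix j :: 'u
  have "small {j}" unfolding small_def
    by (rule finite_ordLess_infinite[OF card_of_Well_order card_of_Well_order])
      (simp_all add: Field_card_of inf)
  moreover have "X \<in> Ob C" "Y \<in> Ob C" using Hom_ob[OF f] by auto
  ultimately show ?thesis
    using epi epi_iff_jointly_epic[OF f, of j] Gen_iff_jointly_epic[OF cop] by blast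
qed

lemma Gen_refl:
  assumes "infinite (UNIV :: 'u set)" and "has_coproducts TYPE('u) C" and "X \<in> Ob C"
  shows "X \<in> Gen TYPE('u) C X"
  using Gen_epi[OF assms(1,2) ident_in split_epi_epi[OF ident_in ident_in comp_ident[OF ident_in]]]
    assms(3) by blast

end

section \<open>Adjunctions with faithful exact right adjoint\<close>

lemma additive_functor_zero:
  assumes T: "additive_functor C D T" and C: "preadditive_category C" and D: "preadditive_category D"
    and X: "X \<in> Ob C" and Y: "Y \<in> Ob C"
  shows "AMap T (Zero C X Y) = Zero D (OMap T X) (OMap T Y)"
proof -
  have "is_functor C D T"
    and hom: "AMap T \<in> hom (hom_group C X Y) (hom_group D (OMap T X) (OMap T Y))"
    using T X Y by (auto simp: additive_functor_def)
  then interpret T: is_functor C D T by simp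
  have "group (hom_group C X Y)" and "group (hom_group D (OMap T X) (OMap T Y))"
    using preadditive_category.hom_comm_group[OF C X Y] comm_group.axioms(2)
      preadditive_category.hom_comm_group[OF D T.omap_in[OF X] T.omap_in[OF Y]] by auto
  then have "AMap T \<one>\<^bsub>hom_group C X Y\<^esub> = \<one>\<^bsub>hom_group D (OMap T X) (OMap T Y)\<^esub>"
    by (rule hom_one[OF hom])
  then show ?thesis by (simp add: hom_group_def)
qed

lemma (in is_functor) iso_amap:
  assumes f: "f \<in> Hom C X Y" and iso: "iso_ar C f"
  shows "iso_ar D (AMap T f)"
proof -
  obtain g where g: "g \<in> Hom C Y X" and gf: "g \<cdot>\<^bsub>C\<^esub> f = Ident C X"
    and fg: "f \<cdot>\<^bsub>C\<^esub> g = Ident C Y"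
    using source.iso_ar_inverse[OF iso f] by blast
  have "X \<in> Ob C" "Y \<in> Ob C" using source.Hom_ob[OF f] by auto
  then have "AMap T g \<cdot>\<^bsub>D\<^esub> AMap T f = Ident D (OMap T X)"
    and "AMap T f \<cdot>\<^bsub>D\<^esub> AMap T g = Ident D (OMap T Y)"
    using amap_comp[OF f g] amap_comp[OF g f] gf fg amap_ident by auto
  then show ?thesis
    using amap_in[OF g] Hom_D[OF amap_in[OF f]] unfolding iso_ar_def by auto
qed

locale faithful_exact_adjunction = B: abelian_category B + A: abelian_category A
  for B :: "('bo, 'bm) cat" and A :: "('ao, 'am) cat" +
  fixes l :: "('bo, 'bm, 'ao, 'am) cfunctor" and e :: "('ao, 'am, 'bo, 'bm) cfunctor"
    and \<eta> :: "'bo \<Rightarrow> 'bm" and \<mu> :: "'ao \<Rightarrow> 'am"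
  assumes adj: "adjunction B A l e \<eta> \<mu>"
    and faithful: "faithful A e" and exact: "exact_functor A B e"
begin

sublocale l: is_functor B A l using adj by (simp add: adjunction_def)
sublocale e: is_functor A B e using adj by (simp add: adjunction_def)

text \<open>The adjunction bijection from maps \<open>l X \<rightarrow> Y\<close> to maps
  \<open>X \<rightarrow> e Y\<close>. Its inverse sends \<open>g\<close> to \<open>\<mu> Y\<close>
  composed with \<open>l g\<close>; \<open>tr_post\<close> and \<open>tr_pre\<close> are its
  naturality in the two variables.\<close>

definition tr :: "'bo \<Rightarrow> 'am \<Rightarrow> 'bm" where
  "tr X f = AMap e f \<cdot>\<^bsub>B\<^esub> \<eta> X"

lemma eta_in: "X \<in> Ob B \<Longrightarrow> \<eta> X \<in> Hom B X (OMap e (OMap l X))"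
  using adj by (simp add: adjunction_def nat_trans_def id_functor_def comp_functor_def)

lemma mu_in: "Y \<in> Ob A \<Longrightarrow> \<mu> Y \<in> Hom A (OMap l (OMap e Y)) Y"
  using adj by (simp add: adjunction_def nat_trans_def id_functor_def comp_functor_def)

lemma eta_nat: "f \<in> Hom B X Y \<Longrightarrow> \<eta> Y \<cdot>\<^bsub>B\<^esub> f = AMap e (AMap l f) \<cdot>\<^bsub>B\<^esub> \<eta> X"
  using adj by (simp add: adjunction_def nat_trans_def id_functor_def comp_functor_def)

lemma mu_nat: "f \<in> Hom A X Y \<Longrightarrow> \<mu> Y \<cdot>\<^bsub>A\<^esub> AMap l (AMap e f) = f \<cdot>\<^bsub>A\<^esub> \<mu> X"
  using adj by (simp add: adjunction_def nat_trans_def id_functor_def comp_functor_def)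

lemma triangle_l: "X \<in> Ob B \<Longrightarrow> \<mu> (OMap l X) \<cdot>\<^bsub>A\<^esub> AMap l (\<eta> X) = Ident A (OMap l X)"
  using adj by (simp add: adjunction_def)

lemma triangle_e: "Y \<in> Ob A \<Longrightarrow> AMap e (\<mu> Y) \<cdot>\<^bsub>B\<^esub> \<eta> (OMap e Y) = Ident B (OMap e Y)"
  using adj by (simp add: adjunction_def)

lemma tr_in: "\<lbrakk>X \<in> Ob B; f \<in> Hom A (OMap l X) Y\<rbrakk> \<Longrightarrow> tr X f \<in> Hom B X (OMap e Y)"
  unfolding tr_def using B.comp_in[OF eta_in e.amap_in] .

lemma tr_post:
  assumes "X \<in> Ob B" and f: "f \<in> Hom A (OMap l X) Y" and h: "h \<in> Hom A Y Z"
  shows "tr X (h \<cdot>\<^bsub>A\<^esub> f) = AMap e h \<cdot>\<^bsub>B\<^esub> tr X f"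
  unfolding tr_def using e.amap_comp[OF f h]
    B.comp_assoc[OF eta_in[OF assms(1)] e.amap_in[OF f] e.amap_in[OF h]] by simp

lemma tr_pre:
  assumes f: "f \<in> Hom A (OMap l X) Y" and g: "g \<in> Hom B W X"
  shows "tr W (f \<cdot>\<^bsub>A\<^esub> AMap l g) = tr X f \<cdot>\<^bsub>B\<^esub> g"
proof -
  have ob: "W \<in> Ob B" "X \<in> Ob B" using B.Hom_ob[OF g] by auto
  have "tr W (f \<cdot>\<^bsub>A\<^esub> AMap l g) = AMap e f \<cdot>\<^bsub>B\<^esub> (\<eta> X \<cdot>\<^bsub>B\<^esub> g)"
    using tr_post[OF ob(1) l.amap_in[OF g] f] eta_nat[OF g] by (simp add: tr_def)
  then show ?thesis
    using B.comp_assoc[OF g eta_in[OF ob(2)] e.amap_in[OF f]] by (simp add: tr_def)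
qed

lemma tr_surj:
  assumes Y: "Y \<in> Ob A" and g: "g \<in> Hom B X (OMap e Y)"
  shows "\<exists>f \<in> Hom A (OMap l X) Y. tr X f = g"
proof
  have X: "X \<in> Ob B" using B.Hom_ob[OF g] by blast
  show "\<mu> Y \<cdot>\<^bsub>A\<^esub> AMap l g \<in> Hom A (OMap l X) Y"
    by (rule A.comp_in[OF l.amap_in[OF g] mu_in[OF Y]])
  have "tr X (\<mu> Y \<cdot>\<^bsub>A\<^esub> AMap l g) = tr (OMap e Y) (\<mu> Y) \<cdot>\<^bsub>B\<^esub> g"
    by (rule tr_pre[OF mu_in[OF Y] g])
  then show "tr X (\<mu> Y \<cdot>\<^bsub>A\<^esub> AMap l g) = g"
    using triangle_e[OF Y] B.ident_comp[OF g] by (simp add: tr_def)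
qed

text \<open>Naturality of the counit moves \<open>f\<close> to the left, leaving the triangle
  identity for \<open>l\<close>. This is the half of the bijection that gives injectivity of
  \<open>tr\<close>.\<close>

lemma mu_l_tr:
  assumes X: "X \<in> Ob B" and f: "f \<in> Hom A (OMap l X) Y"
  shows "\<mu> Y \<cdot>\<^bsub>A\<^esub> AMap l (tr X f) = f"
proof -
  have Y: "Y \<in> Ob A" using A.Hom_ob[OF f] by blast
  have l\<eta>: "AMap l (\<eta> X) \<in> Hom A (OMap l X) (OMap l (OMap e (OMap l X)))"
    by (rule l.amap_in[OF eta_in[OF X]])
  have "\<mu> Y \<cdot>\<^bsub>A\<^esub> AMap l (tr X f) = (\<mu> Y \<cdot>\<^bsub>A\<^esub> AMap l (AMap e f)) \<cdot>\<^bsub>A\<^esub> AMap l (\<eta> X)"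
    using l.amap_comp[OF eta_in[OF X] e.amap_in[OF f]]
      A.comp_assoc[OF l\<eta> l.amap_in[OF e.amap_in[OF f]] mu_in[OF Y]] by (simp add: tr_def)
  also have "\<dots> = f \<cdot>\<^bsub>A\<^esub> (\<mu> (OMap l X) \<cdot>\<^bsub>A\<^esub> AMap l (\<eta> X))"
    using mu_nat[OF f] A.comp_assoc[OF l\<eta> mu_in[OF l.omap_in[OF X]] f] by simp
  also have "\<dots> = f" using triangle_l[OF X] A.comp_ident[OF f] by simp
  finally show ?thesis .
qed

lemma tr_inj:
  "\<lbrakk>X \<in> Ob B; f \<in> Hom A (OMap l X) Y; g \<in> Hom A (OMap l X) Y; tr X f = tr X g\<rbrakk> \<Longrightarrow> f = g"
  using mu_l_tr by metis

lemma e_faithful: "\<lbrakk>f \<in> Hom A X Y; g \<in> Hom A X Y; AMap e f = AMap e g\<rbrakk> \<Longrightarrow> f = g"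
  using faithful A.Hom_ob[of f X Y] unfolding faithful_def inj_on_def by blast

lemma e_epi: "epi_ar A f \<Longrightarrow> epi_ar B (AMap e f)"
  by (rule exact_functor_epi[OF exact A.abelian_category_axioms])

lemma e_kernel:
  assumes "epi_ar A g" and "is_kernel A k g"
  shows "is_kernel B (AMap e k) (AMap e g)"
  using A.short_exact_of_kernel[OF assms] exact B.short_exact_kernel
  unfolding exact_functor_def by blast

lemma tr_zero:
  assumes "X \<in> Ob B" and "Y \<in> Ob A"
  shows "tr X (Zero A (OMap l X) Y) = Zero B X (OMap e Y)"
proof -
  have "AMap e (Zero A (OMap l X) Y) = Zero B (OMap e (OMap l X)) (OMap e Y)"
    using additive_functor_zero[OF _ A.preadditive_category_axioms B.preadditive_category_axioms]
      exact l.omap_in assms by (auto simp: exact_functor_def)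
  then show ?thesis
    unfolding tr_def using B.zero_comp[OF eta_in[OF assms(1)] e.omap_in[OF assms(2)]] by simp
qed

section \<open>What the left adjoint \<open>l\<close> preserves\<close>

lemma l_zero:
  assumes X: "X \<in> Ob B" and Y: "Y \<in> Ob B"
  shows "AMap l (Zero B X Y) = Zero A (OMap l X) (OMap l Y)"
proof (rule tr_inj[OF X])
  have 0: "Zero B X Y \<in> Hom B X Y" by (rule B.zero_in[OF X Y])
  show "AMap l (Zero B X Y) \<in> Hom A (OMap l X) (OMap l Y)" by (rule l.amap_in[OF 0])
  show "Zero A (OMap l X) (OMap l Y) \<in> Hom A (OMap l X) (OMap l Y)"
    by (rule A.zero_in[OF l.omap_in[OF X] l.omap_in[OF Y]])
  \<comment> \<open>\<open>l\<close> is given only as a functor; that it preserves zero morphisms is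
    seen after transposition, where both sides become zero.\<close>
  show "tr X (AMap l (Zero B X Y)) = tr X (Zero A (OMap l X) (OMap l Y))"
    using eta_nat[OF 0] B.comp_zero[OF eta_in[OF Y] X] tr_zero[OF X l.omap_in[OF Y]]
    by (simp add: tr_def)
qed

text \<open>By \<open>tr_pre\<close>, precomposing with \<open>l (f j)\<close> becomes precomposing
  the transpose with \<open>f j\<close>, so cancellation takes place in \<open>B\<close>.\<close>

lemma l_jointly_epic:
  assumes f: "jointly_epic B X Y I f" and Y: "Y \<in> Ob B"
  shows "jointly_epic A (OMap l X) (OMap l Y) I (\<lambda>j. AMap l (f j))"
  unfolding jointly_epic_def
proof (intro conjI ballI allI impI)
  have fH: "f j \<in> Hom B X Y" if "j \<in> I" for j using f that by (simp add: jointly_epic_def)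
  then show "AMap l (f j) \<in> Hom A (OMap l X) (OMap l Y)" if "j \<in> I" for j
    using l.amap_in that by blast
  fix Z u v assume u: "u \<in> Hom A (OMap l Y) Z" and v: "v \<in> Hom A (OMap l Y) Z"
    and eq: "\<forall>j \<in> I. u \<cdot>\<^bsub>A\<^esub> AMap l (f j) = v \<cdot>\<^bsub>A\<^esub> AMap l (f j)"
  have "\<forall>j \<in> I. tr Y u \<cdot>\<^bsub>B\<^esub> f j = tr Y v \<cdot>\<^bsub>B\<^esub> f j"
    using eq tr_pre[OF u fH] tr_pre[OF v fH] by metis
  then have "tr Y u = tr Y v"
    using f tr_in[OF Y u] tr_in[OF Y v] unfolding jointly_epic_def by blast
  then show "u = v" by (rule tr_inj[OF Y u v])
qed

lemma l_epi:
  assumes f: "f \<in> Hom B X Y" and epi: "epi_ar B f"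
  shows "epi_ar A (AMap l f)"
proof -
  have "jointly_epic B X Y {()} (\<lambda>_. f)" using epi B.epi_iff_jointly_epic[OF f, of "()"] by blast
  then have "jointly_epic A (OMap l X) (OMap l Y) {()} (\<lambda>_. AMap l f)"
    using l_jointly_epic B.Hom_ob[OF f] by blast
  then show ?thesis using A.epi_iff_jointly_epic[OF l.amap_in[OF f], of "()"] by blast
qed

lemma jointly_epic_of_tr:
  assumes X: "X \<in> Ob B" and g: "\<And>j. j \<in> I \<Longrightarrow> g j \<in> Hom A (OMap l X) L"
    and tr: "jointly_epic B X (OMap e L) I (\<lambda>j. tr X (g j))"
  shows "jointly_epic A (OMap l X) L I g"
  unfolding jointly_epic_def
proof (intro conjI ballI allI impI)
  fix Z u v assume u: "u \<in> Hom A L Z" and v: "v \<in> Hom A L Z"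
    and eq: "\<forall>j \<in> I. u \<cdot>\<^bsub>A\<^esub> g j = v \<cdot>\<^bsub>A\<^esub> g j"
  have "\<forall>j \<in> I. AMap e u \<cdot>\<^bsub>B\<^esub> tr X (g j) = AMap e v \<cdot>\<^bsub>B\<^esub> tr X (g j)"
    using eq tr_post[OF X g u] tr_post[OF X g v] by metis
  then have "AMap e u = AMap e v"
    using tr e.amap_in[OF u] e.amap_in[OF v] unfolding jointly_epic_def by blast
  then show "u = v" by (rule e_faithful[OF u v])
qed (rule g)

text \<open>A map that kills \<open>l f\<close> transposes to one that kills \<open>f\<close>; the
  latter factors through \<open>c\<close>, and the factor transposes back.\<close>

lemma l_cokernel:
  assumes f: "f \<in> Hom B X Y" and c: "is_cokernel B c f"
  shows "is_cokernel A (AMap l c) (AMap l f)"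
proof -
  have ob: "X \<in> Ob B" "Y \<in> Ob B" using B.Hom_ob[OF f] by auto
  note cH = B.is_cokernelD(1)[OF c f]
  have Q: "Cod B c \<in> Ob B" using B.Hom_ob[OF cH] by blast
  show ?thesis
  proof (rule A.is_cokernelI[OF l.amap_in[OF f] l.amap_in[OF cH]])
    show "AMap l c \<cdot>\<^bsub>A\<^esub> AMap l f = Zero A (OMap l X) (OMap l (Cod B c))"
      using l.amap_comp[OF f cH] B.is_cokernelD(2)[OF c f] l_zero[OF ob(1) Q] by simp
    show "epi_ar A (AMap l c)" by (rule l_epi[OF cH B.cokernel_epi[OF c]])
    fix W t assume t: "t \<in> Hom A (OMap l Y) W"
      and tf: "t \<cdot>\<^bsub>A\<^esub> AMap l f = Zero A (OMap l X) W"
    have W: "W \<in> Ob A" using A.Hom_ob[OF t] by blast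
    have "tr Y t \<cdot>\<^bsub>B\<^esub> f = Zero B X (OMap e W)"
      using tr_pre[OF t f] tf tr_zero[OF ob(1) W] by simp
    then obtain u where u: "u \<in> Hom B (Cod B c) (OMap e W)" and uc: "u \<cdot>\<^bsub>B\<^esub> c = tr Y t"
      using B.is_cokernelD(3)[OF c f tr_in[OF ob(2) t]] by blast
    obtain u' where u': "u' \<in> Hom A (OMap l (Cod B c)) W" and "tr (Cod B c) u' = u"
      using tr_surj[OF W u] by blast
    then have "tr Y (u' \<cdot>\<^bsub>A\<^esub> AMap l c) = tr Y t" using tr_pre[OF u' cH] uc by simp
    then have "u' \<cdot>\<^bsub>A\<^esub> AMap l c = t"
      by (rule tr_inj[OF ob(2) A.comp_in[OF l.amap_in[OF cH] u'] t])
    then show "\<exists>u \<in> Hom A (OMap l (Cod B c)) W. u \<cdot>\<^bsub>A\<^esub> AMap l c = t" using u' by blast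
  qed
qed

text \<open>A lifting problem for \<open>l P\<close> along an epi \<open>g\<close> transposes to one
  for \<open>P\<close> along \<open>e g\<close>, which is epic because \<open>e\<close> is
  exact.\<close>

lemma l_projective:
  assumes P: "projective_ob B P"
  shows "projective_ob A (OMap l P)"
  unfolding projective_ob_def
proof (intro conjI allI impI ballI)
  have ob: "P \<in> Ob B" using P by (simp add: projective_ob_def)
  then show "OMap l P \<in> Ob A" by (rule l.omap_in)
  fix g f assume epi: "epi_ar A g" and f: "f \<in> Hom A (OMap l P) (Cod A g)"
  have g: "g \<in> Hom A (Dom A g) (Cod A g)" using epi by (simp add: epi_ar_def Hom_def)
  have Y: "Dom A g \<in> Ob A" using A.Hom_ob[OF g] by blast
  obtain h where h: "h \<in> Hom B P (OMap e (Dom A g))" and gh: "AMap e g \<cdot>\<^bsub>B\<^esub> h = tr P f"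
    using P e_epi[OF epi] tr_in[OF ob f] Hom_D[OF e.amap_in[OF g]]
    unfolding projective_ob_def by metis
  obtain h' where h': "h' \<in> Hom A (OMap l P) (Dom A g)" and "tr P h' = h"
    using tr_surj[OF Y h] by blast
  then have "tr P (g \<cdot>\<^bsub>A\<^esub> h') = tr P f" using tr_post[OF ob h' g] gh by simp
  then have "g \<cdot>\<^bsub>A\<^esub> h' = f" by (rule tr_inj[OF ob A.comp_in[OF h' g] f])
  then show "\<exists>h \<in> Hom A (OMap l P) (Dom A g). g \<cdot>\<^bsub>A\<^esub> h = f" using h' by blast
qed

text \<open>Since \<open>p\<close> is epic, exactness makes it a cokernel of
  \<open>\<sigma>\<close>, and \<open>l\<close> preserves cokernels and projectives.\<close>

lemma l_projective_presentation:
  assumes "projective_presentation B \<sigma> p X"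
  shows "projective_presentation A (AMap l \<sigma>) (AMap l p) (OMap l X)"
proof -
  have P: "projective_ob B (Dom B \<sigma>)" and Q: "projective_ob B (Cod B \<sigma>)"
    and X: "Cod B p = X" and ex: "exact_at B \<sigma> p" and epi: "epi_ar B p"
    using assms by (auto simp: projective_presentation_def)
  have \<sigma>: "\<sigma> \<in> Hom B (Dom B \<sigma>) (Cod B \<sigma>)" and p: "p \<in> Hom B (Cod B \<sigma>) X"
    using ex X by (auto simp: exact_at_def Hom_def)
  have "is_cokernel A (AMap l p) (AMap l \<sigma>)"
    by (rule l_cokernel[OF \<sigma> B.exact_at_epi_cokernel[OF ex epi]])
  then show ?thesis
    using A.cokernel_exact_at A.cokernel_epi l_projective[OF P] l_projective[OF Q]
      Hom_D[OF l.amap_in[OF \<sigma>]] Hom_D[OF l.amap_in[OF p]]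
    unfolding projective_presentation_def by simp
qed

lemma D_class_l_iff:
  assumes \<sigma>: "\<sigma> \<in> Hom B P Q" and L: "L \<in> Ob A"
  shows "L \<in> D_class A (AMap l \<sigma>) \<longleftrightarrow> OMap e L \<in> D_class B \<sigma>"
proof -
  have ob: "P \<in> Ob B" "Q \<in> Ob B" using B.Hom_ob[OF \<sigma>] by auto
  have "(\<forall>g \<in> Hom A (OMap l P) L. \<exists>h \<in> Hom A (OMap l Q) L. h \<cdot>\<^bsub>A\<^esub> AMap l \<sigma> = g) \<longleftrightarrow>
    (\<forall>g \<in> Hom B P (OMap e L). \<exists>h \<in> Hom B Q (OMap e L). h \<cdot>\<^bsub>B\<^esub> \<sigma> = g)"
  proof (intro iffI ballI)
    fix g assume *: "\<forall>g \<in> Hom A (OMap l P) L. \<exists>h \<in> Hom A (OMap l Q) L. h \<cdot>\<^bsub>A\<^esub> AMap l \<sigma> = g"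
      and g: "g \<in> Hom B P (OMap e L)"
    obtain f where f: "f \<in> Hom A (OMap l P) L" and tf: "tr P f = g" using tr_surj[OF L g] by blast
    obtain h where h: "h \<in> Hom A (OMap l Q) L" and hs: "h \<cdot>\<^bsub>A\<^esub> AMap l \<sigma> = f" using * f by blast
    have "tr Q h \<cdot>\<^bsub>B\<^esub> \<sigma> = g" using tr_pre[OF h \<sigma>] hs tf by simp
    then show "\<exists>h \<in> Hom B Q (OMap e L). h \<cdot>\<^bsub>B\<^esub> \<sigma> = g" using tr_in[OF ob(2) h] by blast
  next
    fix f assume *: "\<forall>g \<in> Hom B P (OMap e L). \<exists>h \<in> Hom B Q (OMap e L). h \<cdot>\<^bsub>B\<^esub> \<sigma> = g"
      and f: "f \<in> Hom A (OMap l P) L"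
    obtain h where h: "h \<in> Hom B Q (OMap e L)" and hs: "h \<cdot>\<^bsub>B\<^esub> \<sigma> = tr P f"
      using * tr_in[OF ob(1) f] by blast
    obtain h' where h': "h' \<in> Hom A (OMap l Q) L" and "tr Q h' = h" using tr_surj[OF L h] by blast
    then have "tr P (h' \<cdot>\<^bsub>A\<^esub> AMap l \<sigma>) = tr P f" using tr_pre[OF h' \<sigma>] hs by simp
    then have "h' \<cdot>\<^bsub>A\<^esub> AMap l \<sigma> = f"
      by (rule tr_inj[OF ob(1) A.comp_in[OF l.amap_in[OF \<sigma>] h'] f])
    then show "\<exists>h \<in> Hom A (OMap l Q) L. h \<cdot>\<^bsub>A\<^esub> AMap l \<sigma> = f" using h' by blast
  qed
  then show ?thesis
    unfolding B.D_class_iff[OF \<sigma>] A.D_class_iff[OF l.amap_in[OF \<sigma>]] using L e.omap_in by blast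
qed

section \<open>The counit and the splitting behind \<open>F\<close>\<close>

lemma mu_epi:
  assumes Y: "Y \<in> Ob A"
  shows "epi_ar A (\<mu> Y)"
proof (rule A.epi_arI[OF mu_in[OF Y]])
  note \<mu> = mu_in[OF Y]
  fix W u v assume u: "u \<in> Hom A Y W" and v: "v \<in> Hom A Y W"
    and "u \<cdot>\<^bsub>A\<^esub> \<mu> Y = v \<cdot>\<^bsub>A\<^esub> \<mu> Y"
  then have "AMap e u \<cdot>\<^bsub>B\<^esub> AMap e (\<mu> Y) = AMap e v \<cdot>\<^bsub>B\<^esub> AMap e (\<mu> Y)"
    using e.amap_comp[OF \<mu> u] e.amap_comp[OF \<mu> v] by simp
  \<comment> \<open>The triangle identity for \<open>e\<close> splits \<open>e (\<mu> Y)\<close>;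
    faithfulness then carries the cancellation back to \<open>A\<close>.\<close>
  moreover have "epi_ar B (AMap e (\<mu> Y))"
    by (rule B.split_epi_epi[OF e.amap_in[OF \<mu>] eta_in[OF e.omap_in[OF Y]] triangle_e[OF Y]])
  ultimately have "AMap e u = AMap e v"
    using B.epi_arD e.amap_in[OF \<mu>] e.amap_in[OF u] e.amap_in[OF v] by blast
  then show "u = v" by (rule e_faithful[OF u v])
qed

text \<open>By exactness of \<open>e\<close>, applying it to the kernel of \<open>\<mu> N\<close>
  gives a kernel of \<open>e (\<mu> N)\<close>, and the unit at \<open>e N\<close> is a section of
  that map.\<close>

lemma D_class_ele_iff:
  assumes \<sigma>: "\<sigma> \<in> Hom B P Q" and P: "projective_ob B P" and Q: "projective_ob B Q"
    and N: "N \<in> Ob A"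
  shows "OMap e (OMap l (OMap e N)) \<in> D_class B \<sigma> \<longleftrightarrow>
    OMap e N \<in> D_class B \<sigma> \<and> OMap e (Dom A (ker A (\<mu> N))) \<in> D_class B \<sigma>"
proof -
  note \<mu> = mu_in[OF N] and eN = e.omap_in[OF N]
  have k: "is_kernel A (ker A (\<mu> N)) (\<mu> N)"
    unfolding ker_def using A.ex_kernel Hom_D[OF \<mu>] by (metis someI_ex)
  have "Dom B (AMap e (ker A (\<mu> N))) = OMap e (Dom A (ker A (\<mu> N)))"
    using Hom_D[OF e.amap_in[OF A.is_kernelD(1)[OF k \<mu>]]] by blast
  then show ?thesis
    using B.D_class_split_extension[OF \<sigma> P Q e.amap_in[OF \<mu>] eta_in[OF eN] triangle_e[OF N]
        e_kernel[OF mu_epi[OF N] k]] by simp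
qed

section \<open>\<open>Gen\<close> along \<open>l\<close> and \<open>e\<close>\<close>

lemma Gen_l:
  assumes copB: "has_coproducts TYPE('u) B" and copA: "has_coproducts TYPE('u) A"
    and X: "X \<in> Ob B" and Y: "Y \<in> Gen TYPE('u) B X"
  shows "OMap l Y \<in> Gen TYPE('u) A (OMap l X)"
  using Y l_jointly_epic[of X Y] l.omap_in
  unfolding B.Gen_iff_jointly_epic[OF copB X] A.Gen_iff_jointly_epic[OF copA l.omap_in[OF X]]
  by blast

text \<open>\<open>e\<close> preserves single epimorphisms, so the family is kept assembled as one
  epi from a coproduct, which \<open>e\<close> also preserves.\<close>

lemma Gen_e:
  assumes pres: "preserves_coproducts TYPE('u) A B e" and Y: "Y \<in> Gen TYPE('u) A X"
  shows "OMap e Y \<in> Gen TYPE('u) B (OMap e X)"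
proof -
  obtain I :: "'u set" and S \<iota> f where "Y \<in> Ob A" and I: "small I"
    and S: "is_coproduct A I (\<lambda>_. X) S \<iota>" and f: "f \<in> Hom A S Y" and epi: "epi_ar A f"
    using Y unfolding Gen_def by blast
  have "is_coproduct B I (\<lambda>_. OMap e X) (OMap e S) (\<lambda>j. AMap e (\<iota> j))"
    using pres I S unfolding preserves_coproducts_def by blast
  then show ?thesis
    using I e.amap_in[OF f] e_epi[OF epi] e.omap_in[OF \<open>Y \<in> Ob A\<close>] unfolding Gen_def by blast
qed

lemma Gen_of_e:
  assumes copB: "has_coproducts TYPE('u) B" and copA: "has_coproducts TYPE('u) A"
    and X: "X \<in> Ob B" and L: "L \<in> Ob A" and eL: "OMap e L \<in> Gen TYPE('u) B X"
  shows "L \<in> Gen TYPE('u) A (OMap l X)"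
proof -
  obtain I :: "'u set" and f where I: "small I" and f: "jointly_epic B X (OMap e L) I f"
    using eL unfolding B.Gen_iff_jointly_epic[OF copB X] by blast
  have "\<forall>j \<in> I. \<exists>g. g \<in> Hom A (OMap l X) L \<and> tr X g = f j"
    using f tr_surj[OF L] unfolding jointly_epic_def by blast
  then obtain g where g: "\<And>j. j \<in> I \<Longrightarrow> g j \<in> Hom A (OMap l X) L" "\<And>j. j \<in> I \<Longrightarrow> tr X (g j) = f j"
    by metis
  have "jointly_epic B X (OMap e L) I (\<lambda>j. tr X (g j))"
    using f g(2) unfolding jointly_epic_def by simp
  with g(1) have "jointly_epic A (OMap l X) L I g" by (rule jointly_epic_of_tr[OF X])
  then show ?thesis
    using I L unfolding A.Gen_iff_jointly_epic[OF copA l.omap_in[OF X]] by blast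
qed

end

section \<open>Cleft extensions\<close>

locale cleft = faithful_exact_adjunction B A l e \<eta> \<mu>
  for B :: "('bo, 'bm) cat" and A :: "('ao, 'am) cat"
    and l :: "('bo, 'bm, 'ao, 'am) cfunctor" and e :: "('ao, 'am, 'bo, 'bm) cfunctor"
    and \<eta> :: "'bo \<Rightarrow> 'bm" and \<mu> :: "'ao \<Rightarrow> 'am" +
  fixes i :: "('bo, 'bm, 'ao, 'am) cfunctor" and \<theta> :: "'bo \<Rightarrow> 'bm"
  assumes i_functor: "is_functor B A i"
    and section_iso: "nat_iso B B (e \<circ>\<^sub>F i) id_functor \<theta>"
begin

sublocale i: is_functor B A i by (rule i_functor)

lemma theta_in: "X \<in> Ob B \<Longrightarrow> \<theta> X \<in> Hom B (OMap e (OMap i X)) X"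
  using section_iso by (simp add: nat_iso_def nat_trans_def id_functor_def comp_functor_def)

lemma theta_iso: "X \<in> Ob B \<Longrightarrow> iso_ar B (\<theta> X)"
  using section_iso by (simp add: nat_iso_def)

lemma theta_nat: "f \<in> Hom B X Y \<Longrightarrow> \<theta> Y \<cdot>\<^bsub>B\<^esub> AMap e (AMap i f) = f \<cdot>\<^bsub>B\<^esub> \<theta> X"
  using section_iso by (simp add: nat_iso_def nat_trans_def id_functor_def comp_functor_def)

lemma theta_cancel_left:
  assumes X: "X \<in> Ob B" and u: "u \<in> Hom B W (OMap e (OMap i X))"
    and v: "v \<in> Hom B W (OMap e (OMap i X))" and eq: "\<theta> X \<cdot>\<^bsub>B\<^esub> u = \<theta> X \<cdot>\<^bsub>B\<^esub> v"
  shows "u = v"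
proof -
  obtain t where t: "t \<in> Hom B X (OMap e (OMap i X))"
    and "t \<cdot>\<^bsub>B\<^esub> \<theta> X = Ident B (OMap e (OMap i X))"
    using B.iso_ar_inverse[OF theta_iso[OF X] theta_in[OF X]] by blast
  then show ?thesis
    using B.comp_assoc[OF u theta_in[OF X] t] B.comp_assoc[OF v theta_in[OF X] t] eq
      B.ident_comp[OF u] B.ident_comp[OF v] by metis
qed

section \<open>Comparing D_sigma in \<open>B\<close> with D_(l sigma) in \<open>A\<close>\<close>

context
  fixes \<sigma> P Q
  assumes \<sigma>: "\<sigma> \<in> Hom B P Q" and P: "projective_ob B P" and Q: "projective_ob B Q"
begin

lemma D_class_ei_iff: "X \<in> Ob B \<Longrightarrow> OMap e (OMap i X) \<in> D_class B \<sigma> \<longleftrightarrow> X \<in> D_class B \<sigma>"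
  using B.D_class_iso[OF \<sigma> P theta_in theta_iso] by blast

lemma D_class_i_iff: "X \<in> Ob B \<Longrightarrow> OMap i X \<in> D_class A (AMap l \<sigma>) \<longleftrightarrow> X \<in> D_class B \<sigma>"
  using D_class_l_iff[OF \<sigma> i.omap_in] D_class_ei_iff by blast

lemma D_class_el_iff:
  assumes X: "X \<in> Ob B"
  shows "OMap e (OMap l X) \<in> D_class B \<sigma> \<longleftrightarrow>
    X \<in> D_class B \<sigma> \<and> OMap (cleft_endofunctor A i e l \<mu>) X \<in> D_class B \<sigma>"
proof -
  \<comment> \<open>\<open>F\<close> evaluates the kernel at \<open>i X\<close>, so the splitting
    concerns \<open>e l e i X\<close>; the isomorphism \<open>e (l (\<theta> X))\<close> replaces
    this by \<open>e l X\<close>.\<close>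
  have "OMap e (OMap l (OMap e (OMap i X))) \<in> D_class B \<sigma> \<longleftrightarrow> OMap e (OMap l X) \<in> D_class B \<sigma>"
    by (rule B.D_class_iso[OF \<sigma> P e.amap_in[OF l.amap_in[OF theta_in[OF X]]]
          e.iso_amap[OF l.amap_in[OF theta_in[OF X]] l.iso_amap[OF theta_in[OF X] theta_iso[OF X]]]])
  moreover have "OMap (cleft_endofunctor A i e l \<mu>) X = OMap e (Dom A (ker A (\<mu> (OMap i X))))"
    by (simp add: cleft_endofunctor_def comp_functor_def kernel_functor_def)
  ultimately show ?thesis
    using D_class_ele_iff[OF \<sigma> P Q i.omap_in[OF X]] D_class_ei_iff[OF X] by simp
qed

text \<open>A coproduct in \<open>B\<close> is sent to \<open>A\<close> by \<open>i\<close> and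
  tested with \<open>D_class_i_iff\<close>; a coproduct in \<open>A\<close> is sent to
  \<open>B\<close> by \<open>e\<close> and tested with \<open>D_class_l_iff\<close>.\<close>

lemma torsion_class_l_iff:
  assumes pres_i: "preserves_coproducts TYPE('u) B A i"
    and pres_e: "preserves_coproducts TYPE('u) A B e"
  shows "torsion_class TYPE('u) A (D_class A (AMap l \<sigma>)) \<longleftrightarrow>
    torsion_class TYPE('u) B (D_class B \<sigma>)"
  unfolding B.torsion_class_D_class_iff[OF \<sigma> P Q]
    A.torsion_class_D_class_iff[OF l.amap_in[OF \<sigma>] l_projective[OF P] l_projective[OF Q]]
proof (intro iffI allI impI; elim conjE)
  have ob: "X \<in> Ob B" if "X \<in> D_class B \<sigma>" for X using that by (simp add: D_class_def)
  fix I :: "'u set" and X S \<iota>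
  assume *: "\<forall>(I :: 'u set) X S \<iota>. small I \<and> (\<forall>j \<in> I. X j \<in> D_class A (AMap l \<sigma>)) \<and>
      is_coproduct A I X S \<iota> \<longrightarrow> S \<in> D_class A (AMap l \<sigma>)"
    and I: "small I" and X: "\<forall>j \<in> I. X j \<in> D_class B \<sigma>" and S: "is_coproduct B I X S \<iota>"
  have "is_coproduct A I (\<lambda>j. OMap i (X j)) (OMap i S) (\<lambda>j. AMap i (\<iota> j))"
    using pres_i I S unfolding preserves_coproducts_def by blast
  moreover have "\<forall>j \<in> I. OMap i (X j) \<in> D_class A (AMap l \<sigma>)"
    using X ob D_class_i_iff by blast
  ultimately have "OMap i S \<in> D_class A (AMap l \<sigma>)"
    using I *[THEN spec, THEN spec, THEN spec, THEN spec,
        of I "\<lambda>j. OMap i (X j)" "OMap i S" "\<lambda>j. AMap i (\<iota> j)"] by blast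
  then show "S \<in> D_class B \<sigma>" using D_class_i_iff S by (auto simp: is_coproduct_def)
next
  have ob: "L \<in> Ob A" if "L \<in> D_class A (AMap l \<sigma>)" for L using that by (simp add: D_class_def)
  fix I :: "'u set" and X S \<iota>
  assume *: "\<forall>(I :: 'u set) X S \<iota>. small I \<and> (\<forall>j \<in> I. X j \<in> D_class B \<sigma>) \<and>
      is_coproduct B I X S \<iota> \<longrightarrow> S \<in> D_class B \<sigma>"
    and I: "small I" and X: "\<forall>j \<in> I. X j \<in> D_class A (AMap l \<sigma>)" and S: "is_coproduct A I X S \<iota>"
  have "is_coproduct B I (\<lambda>j. OMap e (X j)) (OMap e S) (\<lambda>j. AMap e (\<iota> j))"
    using pres_e I S unfolding preserves_coproducts_def by blast
  moreover have "\<forall>j \<in> I. OMap e (X j) \<in> D_class B \<sigma>"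
    using X ob D_class_l_iff[OF \<sigma>] by blast
  ultimately have "OMap e S \<in> D_class B \<sigma>"
    using I *[THEN spec, THEN spec, THEN spec, THEN spec,
        of I "\<lambda>j. OMap e (X j)" "OMap e S" "\<lambda>j. AMap e (\<iota> j)"] by blast
  then show "S \<in> D_class A (AMap l \<sigma>)" using D_class_l_iff[OF \<sigma>] S by (auto simp: is_coproduct_def)
qed

end

section \<open>The silting case\<close>

lemma Gen_of_i:
  assumes copB: "has_coproducts TYPE('u) B" and copA: "has_coproducts TYPE('u) A"
    and X: "X \<in> Ob B" and Y: "Y \<in> Ob B" and iY: "OMap i Y \<in> Gen TYPE('u) A (OMap l X)"
  shows "Y \<in> Gen TYPE('u) B X"
proof -
  obtain I :: "'u set" and f where I: "small I" and f: "jointly_epic A (OMap l X) (OMap i Y) I f"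
    using iY unfolding A.Gen_iff_jointly_epic[OF copA l.omap_in[OF X]] by blast
  have fH: "f j \<in> Hom A (OMap l X) (OMap i Y)" if "j \<in> I" for j
    using f that by (simp add: jointly_epic_def)
  have "jointly_epic B X Y I (\<lambda>j. \<theta> Y \<cdot>\<^bsub>B\<^esub> tr X (f j))"
    unfolding jointly_epic_def
  proof (intro conjI ballI allI impI)
    show "\<theta> Y \<cdot>\<^bsub>B\<^esub> tr X (f j) \<in> Hom B X Y" if "j \<in> I" for j
      using B.comp_in[OF tr_in[OF X fH[OF that]] theta_in[OF Y]] .
    fix Z u v assume u: "u \<in> Hom B Y Z" and v: "v \<in> Hom B Y Z"
      and eq: "\<forall>j \<in> I. u \<cdot>\<^bsub>B\<^esub> (\<theta> Y \<cdot>\<^bsub>B\<^esub> tr X (f j)) = v \<cdot>\<^bsub>B\<^esub> (\<theta> Y \<cdot>\<^bsub>B\<^esub> tr X (f j))"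
    have Z: "Z \<in> Ob B" using B.Hom_ob[OF u] by blast
    \<comment> \<open>Naturality of \<open>\<theta>\<close> and of \<open>tr\<close> moves
      \<open>w\<close> inside the transpose as \<open>i w\<close>. Injectivity of \<open>tr\<close>
      then reduces the hypothesis to an equation between \<open>i u\<close> and \<open>i v\<close>
      on the family \<open>f\<close>.\<close>
    have push: "w \<cdot>\<^bsub>B\<^esub> (\<theta> Y \<cdot>\<^bsub>B\<^esub> tr X (f j)) = \<theta> Z \<cdot>\<^bsub>B\<^esub> tr X (AMap i w \<cdot>\<^bsub>A\<^esub> f j)"
      if w: "w \<in> Hom B Y Z" and j: "j \<in> I" for w j
    proof -
      have "w \<cdot>\<^bsub>B\<^esub> (\<theta> Y \<cdot>\<^bsub>B\<^esub> tr X (f j)) = (\<theta> Z \<cdot>\<^bsub>B\<^esub> AMap e (AMap i w)) \<cdot>\<^bsub>B\<^esub> tr X (f j)"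
        using B.comp_assoc[OF tr_in[OF X fH[OF j]] theta_in[OF Y] w] theta_nat[OF w] by simp
      also have "\<dots> = \<theta> Z \<cdot>\<^bsub>B\<^esub> tr X (AMap i w \<cdot>\<^bsub>A\<^esub> f j)"
        using B.comp_assoc[OF tr_in[OF X fH[OF j]] e.amap_in[OF i.amap_in[OF w]] theta_in[OF Z]]
          tr_post[OF X fH[OF j] i.amap_in[OF w]] by simp
      finally show ?thesis .
    qed
    have "AMap i u \<cdot>\<^bsub>A\<^esub> f j = AMap i v \<cdot>\<^bsub>A\<^esub> f j" if j: "j \<in> I" for j
    proof -
      have iuf: "AMap i u \<cdot>\<^bsub>A\<^esub> f j \<in> Hom A (OMap l X) (OMap i Z)"
        and ivf: "AMap i v \<cdot>\<^bsub>A\<^esub> f j \<in> Hom A (OMap l X) (OMap i Z)"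
        using A.comp_in[OF fH[OF j] i.amap_in[OF u]] A.comp_in[OF fH[OF j] i.amap_in[OF v]] by auto
      have "\<theta> Z \<cdot>\<^bsub>B\<^esub> tr X (AMap i u \<cdot>\<^bsub>A\<^esub> f j) = \<theta> Z \<cdot>\<^bsub>B\<^esub> tr X (AMap i v \<cdot>\<^bsub>A\<^esub> f j)"
        using eq j push[OF u j] push[OF v j] by metis
      then have "tr X (AMap i u \<cdot>\<^bsub>A\<^esub> f j) = tr X (AMap i v \<cdot>\<^bsub>A\<^esub> f j)"
        by (rule theta_cancel_left[OF Z tr_in[OF X iuf] tr_in[OF X ivf]])
      then show ?thesis by (rule tr_inj[OF X iuf ivf])
    qed
    then have "AMap i u = AMap i v"
      using f i.amap_in[OF u] i.amap_in[OF v] unfolding jointly_epic_def by blast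
    \<comment> \<open>Naturality of \<open>\<theta>\<close>, whose components are epic, shows that
      \<open>i\<close> is faithful.\<close>
    then have "u \<cdot>\<^bsub>B\<^esub> \<theta> Y = v \<cdot>\<^bsub>B\<^esub> \<theta> Y" using theta_nat[OF u] theta_nat[OF v] by simp
    then show "u = v"
      by (rule B.epi_arD[OF B.iso_epi[OF theta_iso[OF Y] theta_in[OF Y]] theta_in[OF Y] u v])
  qed
  then show ?thesis using I Y unfolding B.Gen_iff_jointly_epic[OF copB X] by blast
qed

lemma Gen_l_eq_D_class_iff:
  assumes inf: "infinite (UNIV :: 'u set)" and reg: "regularCard |UNIV :: 'u set|"
    and copB: "has_coproducts TYPE('u) B" and copA: "has_coproducts TYPE('u) A"
    and pres_e: "preserves_coproducts TYPE('u) A B e"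
    and \<sigma>: "\<sigma> \<in> Hom B P Q" and P: "projective_ob B P" and Q: "projective_ob B Q"
    and X: "X \<in> Ob B"
  shows "Gen TYPE('u) A (OMap l X) = D_class A (AMap l \<sigma>) \<longleftrightarrow>
    Gen TYPE('u) B X = D_class B \<sigma> \<and>
    OMap (cleft_endofunctor A i e l \<mu>) X \<in> Gen TYPE('u) B X"
    (is "?GA = ?DA \<longleftrightarrow> ?GB = ?DB \<and> ?FX \<in> ?GB")
proof
  have lX: "OMap l X \<in> Ob A" by (rule l.omap_in[OF X])
  assume eq: "?GA = ?DA"
  have "OMap e (OMap l X) \<in> ?DB"
    using A.Gen_refl[OF inf copA lX] eq D_class_l_iff[OF \<sigma> lX] by blast
  then have FX: "?FX \<in> ?DB" using D_class_el_iff[OF \<sigma> P Q X] by blast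
  have "Y \<in> ?DB" if Y: "Y \<in> ?GB" for Y
  proof -
    have ob: "Y \<in> Ob B" using Y by (simp add: Gen_def)
    \<comment> \<open>The detour through \<open>A\<close>: \<open>l Y\<close> lies in
      \<open>Gen (l X)\<close>, hence in D_(l sigma), so \<open>e l Y\<close> lies in D_sigma, and
      \<open>Y\<close> does too as its quotient.\<close>
    have "OMap l Y \<in> ?DA" using Gen_l[OF copB copA X Y] eq by blast
    then have "OMap e (OMap l Y) \<in> ?DB" using D_class_l_iff[OF \<sigma> l.omap_in[OF ob]] by blast
    then show ?thesis using D_class_el_iff[OF \<sigma> P Q ob] by blast
  qed
  moreover have "Y \<in> ?GB" if Y: "Y \<in> ?DB" for Y
  proof -
    have ob: "Y \<in> Ob B" using Y by (simp add: D_class_def)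
    then show ?thesis using Gen_of_i[OF copB copA X ob] D_class_i_iff[OF \<sigma> P Q ob] Y eq by blast
  qed
  ultimately show "?GB = ?DB \<and> ?FX \<in> ?GB" using FX by blast
next
  assume eq: "?GB = ?DB \<and> ?FX \<in> ?GB"
  have "X \<in> ?DB" using B.Gen_refl[OF inf copB X] eq by blast
  \<comment> \<open>Both ends \<open>X\<close> and \<open>F X\<close> of the split extension lie in
    D_sigma, hence so does \<open>e l X\<close>; by assumption this class is
    \<open>Gen X\<close>.\<close>
  then have elX: "OMap e (OMap l X) \<in> ?GB" using D_class_el_iff[OF \<sigma> P Q X] eq by blast
  have "L \<in> ?DA" if L: "L \<in> ?GA" for L
  proof -
    have "OMap e L \<in> ?DB" using B.Gen_trans[OF inf reg copB X elX Gen_e[OF pres_e L]] eq by blast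
    then show ?thesis using D_class_l_iff[OF \<sigma>] L by (simp add: Gen_def)
  qed
  moreover have "L \<in> ?GA" if L: "L \<in> ?DA" for L
  proof -
    have ob: "L \<in> Ob A" using L by (simp add: D_class_def)
    then show ?thesis
      using Gen_of_e[OF copB copA X ob] D_class_l_iff[OF \<sigma> ob] L eq by blast
  qed
  ultimately show "?GA = ?DA" by blast
qed

end

theorem theorem3p3:
  fixes B :: "('bo, 'bm) cat" and A :: "('ao, 'am) cat"
    and i l :: "('bo, 'bm, 'ao, 'am) cfunctor" and e :: "('ao, 'am, 'bo, 'bm) cfunctor"
    and \<eta> :: "'bo \<Rightarrow> 'bm" and \<mu> :: "'ao \<Rightarrow> 'am"
    and F :: "('bo, 'bm, 'bo, 'bm) cfunctor"
    and \<sigma> p :: 'bm and P\<^sub>1 P\<^sub>0 X :: 'bo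
  assumes "infinite (UNIV :: 'u set)" and "regularCard |UNIV :: 'u set|"
    and "abelian_category B" and "enough_projectives B" and "enough_injectives B"
    and "has_coproducts TYPE('u) B"
    and "abelian_category A" and "enough_projectives A" and "enough_injectives A"
    and "has_coproducts TYPE('u) A"
    and "cleft_extension B A i e l"
    and "preserves_coproducts TYPE('u) B A i" and "preserves_coproducts TYPE('u) A B e"
    and "adjunction B A l e \<eta> \<mu>" and "F = cleft_endofunctor A i e l \<mu>"
    and "\<sigma> \<in> Hom B P\<^sub>1 P\<^sub>0" and "p \<in> Hom B P\<^sub>0 X" and "projective_presentation B \<sigma> p X"
  shows "projective_presentation A (AMap l \<sigma>) (AMap l p) (OMap l X)
    \<and> (partial_silting TYPE('u) A (AMap l \<sigma>) (OMap l X) \<longleftrightarrow>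
         partial_silting TYPE('u) B \<sigma> X \<and> OMap F X \<in> D_class B \<sigma>)
    \<and> (silting TYPE('u) A (AMap l \<sigma>) (OMap l X) \<longleftrightarrow>
         silting TYPE('u) B \<sigma> X \<and> OMap F X \<in> Gen TYPE('u) B X)"
proof -
  interpret B: abelian_category B by fact
  obtain \<theta> where "nat_iso B B (e \<circ>\<^sub>F i) id_functor \<theta>"
    using assms(11) by (auto simp: cleft_extension_def)
  \<comment> \<open>Any \<open>\<theta>\<close> serves, but the unit and counit must be the given
    ones, since \<open>F\<close> is built from \<open>\<mu>\<close>.\<close>
  then interpret cleft B A l e \<eta> \<mu> i \<theta>
    using assms(3,7,11,14) unfolding cleft_extension_def
    by (intro cleft.intro faithful_exact_adjunction.intro faithful_exact_adjunction_axioms.intro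
        cleft_axioms.intro) auto
  note \<sigma> = \<open>\<sigma> \<in> Hom B P\<^sub>1 P\<^sub>0\<close> and pres = \<open>projective_presentation B \<sigma> p X\<close>
  have X: "X \<in> Ob B" using B.Hom_ob[OF \<open>p \<in> Hom B P\<^sub>0 X\<close>] by blast
  have P: "projective_ob B P\<^sub>1" "projective_ob B P\<^sub>0"
    using pres Hom_D[OF \<sigma>] by (auto simp: projective_presentation_def)
  have lpres: "projective_presentation A (AMap l \<sigma>) (AMap l p) (OMap l X)"
    by (rule l_projective_presentation[OF pres])
  have "OMap l X \<in> D_class A (AMap l \<sigma>) \<longleftrightarrow> X \<in> D_class B \<sigma> \<and> OMap F X \<in> D_class B \<sigma>"
    using D_class_l_iff[OF \<sigma> l.omap_in[OF X]] D_class_el_iff[OF \<sigma> P X]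
    unfolding \<open>F = cleft_endofunctor A i e l \<mu>\<close> by blast
  then show ?thesis
    using pres lpres torsion_class_l_iff[OF \<sigma> P assms(12,13)]
      Gen_l_eq_D_class_iff[OF assms(1,2,6,10,13) \<sigma> P X]
    unfolding partial_silting_def silting_def \<open>F = cleft_endofunctor A i e l \<mu>\<close> by blast
qed

end
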